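(* Let $R$ be an order in $K$ with maximal order $\mathcal{O}_K$, and let $q:\mathcal{O}_K\twoheadrightarrow Q:=\mathcal{O}_K/R$ be the quotient map of abelian groups. The following algorithm is correct, i.e. it returns a list consisting of exactly the over-orders of $R$: start with an empty list $\mathcal{L}^o$; for each subgroup $H'$ of $Q$, let $S$ be the sub-$R$-module of $K$ generated by $q^{-1}(H')$, and if $SS=S$ and $S\notin\mathcal{L}^o$ append $S$ to $\mathcal{L}^o$; return $\mathcal{L}^o$.
   Context: An order is a commutative reduced ring $R$ with unit that is free and finitely generated as a $\mathbb{Z}$-module; its total quotient ring $K$ is a finite product of number fields, and $R$ is called an order in $K$. The maximal order $\mathcal{O}_K$ is the integral closure of $\mathbb{Z}$ in $K$; the quotient $\mathcal{O}_K/R$ is finite. A fractional $R$-ideal is a finitely generated sub-$R$-module $I$ of $K$ with $I\otimes_{\mathbb Z}\mathbb{Q}=K$. An over-order of $R$ is a fractional $R$-ideal that is a subring of $K$ (so it contains $R$). $SS$ denotes the product of $S$ with itself (the additive group generated by products of pairs of elements). *)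

theory Defs
  imports "HOL-Algebra.Algebra" "HOL-Computational_Algebra.Polynomial"
begin

text \<open>
  Throughout, \<open>K\<close> is a ring structure and subsets of \<open>carrier K\<close> play the role of subrings
  and submodules; a subring \<open>R\<close> is viewed as a ring in its own right as \<open>K\<lparr>carrier := R\<rparr>\<close>.
\<close>

definition reduced :: "('a, 'm) ring_scheme \<Rightarrow> bool" where
  "reduced A \<longleftrightarrow>
     (\<forall>x \<in> carrier A. \<forall>n :: nat. x [^]\<^bsub>A\<^esub> n = \<zero>\<^bsub>A\<^esub> \<longrightarrow> x = \<zero>\<^bsub>A\<^esub>)"

text \<open>
  A free and finitely generated \<open>\<int>\<close>-module is one that is isomorphic to the free abelian
  group on a finite set, here \<open>{..<n}\<close>.
\<close>

definition is_order :: "('a, 'm) ring_scheme \<Rightarrow> bool" where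
  "is_order A \<longleftrightarrow>
     cring A \<and> reduced A \<and> (\<exists>n :: nat. add_monoid A \<cong> free_Abelian_group {..<n})"

definition non_zero_divisor :: "('a, 'm) ring_scheme \<Rightarrow> 'a \<Rightarrow> bool" where
  "non_zero_divisor A b \<longleftrightarrow>
     b \<in> carrier A \<and> (\<forall>x \<in> carrier A. b \<otimes>\<^bsub>A\<^esub> x = \<zero>\<^bsub>A\<^esub> \<longrightarrow> x = \<zero>\<^bsub>A\<^esub>)"

text \<open>
  \<open>K\<close> is the localization of its subring \<open>R\<close> at the non-zero-divisors of \<open>R\<close>, with \<open>R\<close> identified
  with its image in the localization.
\<close>

definition total_quotient_ring :: "('a, 'm) ring_scheme \<Rightarrow> 'a set \<Rightarrow> bool" where
  "total_quotient_ring K R \<longleftrightarrow>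
     cring K \<and> subring R K \<and>
     (\<forall>b. non_zero_divisor (K\<lparr>carrier := R\<rparr>) b \<longrightarrow> b \<in> Units K) \<and>
     (\<forall>x \<in> carrier K. \<exists>a \<in> R. \<exists>b. non_zero_divisor (K\<lparr>carrier := R\<rparr>) b \<and>
        x = a \<otimes>\<^bsub>K\<^esub> inv\<^bsub>K\<^esub> b)"

definition order_in :: "'a set \<Rightarrow> ('a, 'm) ring_scheme \<Rightarrow> bool" where
  "order_in R K \<longleftrightarrow> is_order (K\<lparr>carrier := R\<rparr>) \<and> total_quotient_ring K R"

text \<open>The integral closure of \<open>\<int>\<close> in \<open>K\<close>.\<close>

definition maximal_order :: "('a, 'm) ring_scheme \<Rightarrow> 'a set" where
  "maximal_order K =
     {x \<in> carrier K. \<exists>p :: int poly. lead_coeff p = 1 \<and>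
        (\<Oplus>\<^bsub>K\<^esub> i \<in> {..degree p}. [coeff p i] \<cdot>\<^bsub>K\<^esub> (x [^]\<^bsub>K\<^esub> i)) = \<zero>\<^bsub>K\<^esub>}"

text \<open>\<open>K\<close> as a module over its subrings, acting by multiplication.\<close>

definition self_module :: "('a, 'm) ring_scheme \<Rightarrow> ('a, 'a) module" where
  "self_module K =
     \<lparr>carrier = carrier K, monoid.mult = (\<otimes>\<^bsub>K\<^esub>), one = \<one>\<^bsub>K\<^esub>,
      ring.zero = \<zero>\<^bsub>K\<^esub>, ring.add = (\<oplus>\<^bsub>K\<^esub>), module.smult = (\<otimes>\<^bsub>K\<^esub>)\<rparr>"

definition sub_R_module :: "('a, 'm) ring_scheme \<Rightarrow> 'a set \<Rightarrow> 'a set \<Rightarrow> bool" where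
  "sub_R_module K R I \<longleftrightarrow> submodule I (K\<lparr>carrier := R\<rparr>) (self_module K)"

definition generated_module :: "('a, 'm) ring_scheme \<Rightarrow> 'a set \<Rightarrow> 'a set \<Rightarrow> 'a set" where
  "generated_module K R B = \<Inter>{I. sub_R_module K R I \<and> B \<subseteq> I}"

text \<open>
  The image of the canonical map from \<open>I \<otimes> \<rat>\<close> to \<open>K\<close>. Every element of \<open>I \<otimes> \<rat>\<close> is of the
  form \<open>y \<otimes> 1/n\<close> with \<open>y \<in> I\<close> and \<open>n > 0\<close>, and its image \<open>x\<close> is determined by \<open>n x = y\<close>,
  because the total quotient ring \<open>K\<close> of an order is torsion-free. For the same reason the map is
  injective, so \<open>I \<otimes> \<rat> = K\<close> says that its image is \<open>K\<close>.
\<close>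

definition rational_span :: "('a, 'm) ring_scheme \<Rightarrow> 'a set \<Rightarrow> 'a set" where
  "rational_span K I =
     {x \<in> carrier K. \<exists>y \<in> I. \<exists>n :: nat. n > 0 \<and> [n] \<cdot>\<^bsub>K\<^esub> x = y}"

definition fractional_ideal :: "('a, 'm) ring_scheme \<Rightarrow> 'a set \<Rightarrow> 'a set \<Rightarrow> bool" where
  "fractional_ideal K R I \<longleftrightarrow>
     sub_R_module K R I \<and>
     (\<exists>B. finite B \<and> B \<subseteq> carrier K \<and> I = generated_module K R B) \<and>
     rational_span K I = carrier K"

definition over_order :: "('a, 'm) ring_scheme \<Rightarrow> 'a set \<Rightarrow> 'a set \<Rightarrow> bool" where
  "over_order K R S \<longleftrightarrow> fractional_ideal K R S \<and> subring S K"

text \<open>The additive group generated by the products of an element of \<open>S\<close> and one of \<open>T\<close>.\<close>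

definition ideal_mult :: "('a, 'm) ring_scheme \<Rightarrow> 'a set \<Rightarrow> 'a set \<Rightarrow> 'a set" where
  "ideal_mult K S T = generate (add_monoid K) (S <#>\<^bsub>K\<^esub> T)"

text \<open>The abelian group \<open>Q\<close> of cosets of \<open>R\<close> in the maximal order, and the map \<open>q\<close> onto it.\<close>

definition order_quotient :: "('a, 'm) ring_scheme \<Rightarrow> 'a set \<Rightarrow> 'a set monoid" where
  "order_quotient K R = K\<lparr>carrier := maximal_order K\<rparr> A_Mod R"

definition quotient_map :: "('a, 'm) ring_scheme \<Rightarrow> 'a set \<Rightarrow> 'a \<Rightarrow> 'a set" where
  "quotient_map K R x = R +>\<^bsub>K\<lparr>carrier := maximal_order K\<rparr>\<^esub> x"

text \<open>
  The loop over the subgroups of \<open>Q\<close> is a left fold over a list \<open>Hs\<close> of these subgroups; the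
  accumulator is the list of modules found so far.
\<close>

definition over_orders_step ::
    "('a, 'm) ring_scheme \<Rightarrow> 'a set \<Rightarrow> 'a set list \<Rightarrow> 'a set set \<Rightarrow> 'a set list" where
  "over_orders_step K R L H =
     (let S = generated_module K R {x \<in> maximal_order K. quotient_map K R x \<in> H}
      in if ideal_mult K S S = S \<and> S \<notin> set L then L @ [S] else L)"

definition over_orders_algorithm ::
    "('a, 'm) ring_scheme \<Rightarrow> 'a set \<Rightarrow> 'a set set list \<Rightarrow> 'a set list" where
  "over_orders_algorithm K R Hs = foldl (over_orders_step K R) [] Hs"

end

theory Submission
  imports Defs "Jordan_Normal_Form.Schur_Decomposition"
begin

text \<open>
  Over-orders are finitely generated over \<open>R\<close>, hence integral, so they lie between \<open>R\<close> and
  \<open>\<O>\<^sub>K\<close> and correspond to subgroups of \<open>Q\<close>; conversely a module \<open>S\<close> between \<open>R\<close> and \<open>\<O>\<^sub>K\<close> with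
  \<open>S S = S\<close> is a ring, and it is finitely generated because \<open>Q\<close> is finite. The real content is
  the finiteness of \<open>Q\<close>. Integrality of \<open>x \<in> K\<close> is equivalent to a bound on the denominators of
  all powers of \<open>x\<close> with respect to the lattice \<open>R\<close>, which makes \<open>\<O>\<^sub>K\<close> visibly a ring and the
  traces of its elements integers. The trace form is nondegenerate: as \<open>R\<close> is reduced, every nonzero
  \<open>z \<in> R\<close> divides a multiple \<open>e\<close> of a nonzero idempotent of \<open>K\<close>, and the trace of \<open>e\<close> is nonzero.
  Cramer's rule then shows \<open>d \<O>\<^sub>K \<subseteq> R\<close> for the discriminant \<open>d \<noteq> 0\<close> of \<open>R\<close>.
\<close>

section \<open>Finite images and filtering folds\<close>

text \<open>On \<open>A\<close> the map \<open>g\<close> factors through \<open>f\<close>, so one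
  representative for each value of \<open>f\<close> yields all values of \<open>g\<close>. It will
  be applied with \<open>f\<close> the coordinates modulo a common denominator and \<open>g\<close>
  the coset map.\<close>

lemma finite_image_if_determined:
  assumes "finite (f ` A)" and "\<And>x y. x \<in> A \<Longrightarrow> y \<in> A \<Longrightarrow> f x = f y \<Longrightarrow> g x = g y"
  shows "finite (g ` A)"
proof -
  obtain C where C: "C \<subseteq> A" "finite C" "f ` A = f ` C"
    using finite_subset_image[OF assms(1) order_refl] by blast
  have "g ` A \<subseteq> g ` C"
  proof
    fix v assume "v \<in> g ` A"
    then obtain x where x: "x \<in> A" "v = g x" by blast
    then obtain y where "y \<in> C" "f x = f y" using C(3) by blast
    then show "v \<in> g ` C" using assms(2)[OF x(1), of y] C(1) x by auto
  qed
  then show ?thesis using C(2) finite_surj by blast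
qed

text \<open>Each step appends at most one fresh element, so the collected set and distinctness
  follow together; the start list is arbitrary because the induction changes the
  accumulator.\<close>

lemma foldl_collect:
  fixes f :: "'b \<Rightarrow> 'c"
  assumes "\<And>L x. step L x = (if P (f x) \<and> f x \<notin> set L then L @ [f x] else L)" and "distinct L"
  shows "set (foldl step L xs) = set L \<union> {f x | x. x \<in> set xs \<and> P (f x)} \<and> distinct (foldl step L xs)"
  using assms(2)
proof (induction xs arbitrary: L)
  case (Cons x xs)
  have "distinct (step L x)" using Cons.prems by (simp add: assms(1))
  from Cons.IH[OF this] show ?case by (auto simp: assms(1))
qed simp

section \<open>Traces of rational matrices\<close>

text \<open>If \<open>b\<close> is the denominator of \<open>t\<close> in lowest terms, then
  \<open>b ^ s\<close> divides the fixed nonzero \<open>m\<close> for every \<open>s\<close>, which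
  is impossible for \<open>b \<ge> 2\<close> by size.\<close>

lemma rat_Ints_if_powers_bounded_denominator:
  fixes t :: rat
  assumes m: "m \<noteq> (0 :: int)" and int: "\<And>s. of_int m * t ^ s \<in> \<int>"
  shows "t \<in> \<int>"
proof -
  obtain a b where ab: "quotient_of t = (a, b)" by force
  have b: "b > 0" using quotient_of_denom_pos[OF ab] .
  have cop: "coprime a b" using quotient_of_coprime[OF ab] .
  have t: "t = of_int a / of_int b" using quotient_of_div[OF ab] .
  have dvd: "b ^ s dvd m" for s
  proof -
    obtain c where c: "of_int m * t ^ s = of_int c" using int[of s] by (auto elim: Ints_cases)
    have "of_int m * of_int a ^ s = (of_int c * of_int b ^ s :: rat)"
      using c b by (simp add: t power_divide field_simps)
    then have "m * a ^ s = c * b ^ s"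
      by (metis (mono_tags, lifting) of_int_eq_iff of_int_mult of_int_power)
    then have "b ^ s dvd m * a ^ s" by simp
    moreover have "coprime (b ^ s) (a ^ s)" using cop by (simp add: coprime_commute)
    ultimately show ?thesis by (simp add: coprime_dvd_mult_left_iff)
  qed
  have "b = 1"
  proof (rule ccontr)
    assume "b \<noteq> 1"
    then have b2: "b \<ge> 2" using b by simp
    let ?s = "nat \<bar>m\<bar>"
    have "int ?s < 2 ^ ?s" using of_nat_less_two_power[of ?s, where 'a = int] by simp
    also have "(2 :: int) ^ ?s \<le> b ^ ?s" using b2 by (intro power_mono) auto
    also have "\<dots> \<le> \<bar>m\<bar>" using dvd_imp_le_int[OF m dvd[of ?s]] b by simp
    finally show False by simp
  qed
  then show ?thesis using t by simp
qed

lemma det_Ints: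
  fixes A :: "'a :: comm_ring_1 mat"
  assumes A: "A \<in> carrier_mat n n"
    and int: "\<And>i j. i < n \<Longrightarrow> j < n \<Longrightarrow> A $$ (i, j) \<in> \<int>"
  shows "det A \<in> \<int>"
proof -
  have "signof p * (\<Prod>i = 0..<n. A $$ (i, p i)) \<in> (\<int> :: 'a set)" if "p permutes {0..<n}" for p
  proof -
    have "A $$ (i, p i) \<in> \<int>" if "i \<in> {0..<n}" for i
      using that \<open>p permutes _\<close> permutes_in_image[of p "{0..<n}" i] by (intro int) auto
    then show ?thesis by (intro Ints_mult Ints_prod) (auto simp: sign_def)
  qed
  then show ?thesis using A by (auto simp: det_def intro!: Ints_sum)
qed

lemma index_mult_mat_sum:
  assumes "A \<in> carrier_mat n m" "B \<in> carrier_mat m l" "i < n" "j < l"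
  shows "(A * B) $$ (i, j) = (\<Sum>k<m. A $$ (i, k) * B $$ (k, j))"
  using assms by (auto simp: scalar_prod_def lessThan_atLeast0)

text \<open>Laplace expansion along the replaced column involves only cofactors of \<open>U\<close>.
  The sum is therefore the trace of \<open>A * U * adj_mat U\<close>, which is \<open>det U\<close>
  times the trace of \<open>A\<close>.\<close>

lemma sum_det_replace_col_mult:
  fixes A :: "'a :: comm_ring_1 mat"
  assumes A: "A \<in> carrier_mat n n" and U: "U \<in> carrier_mat n n"
  shows "(\<Sum>l<n. det (mat n n (\<lambda>(i, j). if j = l then (A * U) $$ (i, j) else U $$ (i, j)))) =
    (\<Sum>i<n. A $$ (i, i)) * det U"
proof -
  let ?V = "\<lambda>l. mat n n (\<lambda>(i, j). if j = l then (A * U) $$ (i, j) else U $$ (i, j))"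
  have adj: "adj_mat U \<in> carrier_mat n n" "U * adj_mat U = det U \<cdot>\<^sub>m 1\<^sub>m n"
    using adj_mat[OF U] by auto
  have AU: "A * U \<in> carrier_mat n n" using A U by simp
  have col: "det (?V l) = (\<Sum>i<n. (A * U) $$ (i, l) * adj_mat U $$ (l, i))" if l: "l < n" for l
  proof -
    have "mat_delete (?V l) i l = mat_delete U i l" for i
      using U by (auto simp: mat_delete_def intro!: eq_matI)
    then have "cofactor (?V l) i l = cofactor U i l" for i
      by (simp add: cofactor_def)
    then show ?thesis
      using U l by (subst laplace_expansion_column[of _ n l]) (auto simp: adj_mat_def)
  qed
  have "(\<Sum>l<n. det (?V l)) = (\<Sum>l<n. \<Sum>i<n. (A * U) $$ (i, l) * adj_mat U $$ (l, i))"
    by (intro sum.cong) (auto simp: col)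
  also have "\<dots> = (\<Sum>i<n. \<Sum>l<n. (A * U) $$ (i, l) * adj_mat U $$ (l, i))"
    by (rule sum.swap)
  also have "\<dots> = (\<Sum>i<n. (A * U * adj_mat U) $$ (i, i))"
    by (intro sum.cong refl, subst index_mult_mat_sum[OF AU adj(1)]) auto
  also have "A * U * adj_mat U = A * (det U \<cdot>\<^sub>m 1\<^sub>m n)"
    using A U adj by simp
  also have "\<dots> = det U \<cdot>\<^sub>m A" using A by (simp add: mult_smult_distrib[OF A one_carrier_mat])
  finally show ?thesis using A by (simp add: sum_distrib_left mult.commute)
qed

text \<open>
  The trace \<open>t\<close> of \<open>M\<close> acts on the top exterior power: \<open>t * det [u\<^sub>1, \<dots>, u\<^sub>n]\<close> is the sum of
  the determinants with one column \<open>u\<^sub>l\<close> replaced by \<open>M u\<^sub>l\<close>. Hence \<open>t ^ s\<close> is a sum of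
  determinants whose \<open>j\<close>-th column is that of a power of \<open>M\<close>, and its denominator divides \<open>m ^ n\<close>.
\<close>

lemma trace_Ints_if_powers_bounded_denominator:
  fixes M :: "rat mat"
  assumes M: "M \<in> carrier_mat n n" and m: "m \<noteq> (0 :: int)"
    and int: "\<And>k i j. i < n \<Longrightarrow> j < n \<Longrightarrow> of_int m * (M ^\<^sub>m k) $$ (i, j) \<in> \<int>"
  shows "(\<Sum>i<n. M $$ (i, i)) \<in> \<int>"
proof -
  define t where "t = (\<Sum>i<n. M $$ (i, i))"
  define U where "U k = mat n n (\<lambda>(i, j). (M ^\<^sub>m k j) $$ (i, j))" for k :: "nat \<Rightarrow> nat"
  have U: "U k \<in> carrier_mat n n" for k by (simp add: U_def)
  have Mk: "M ^\<^sub>m k \<in> carrier_mat n n" for k using M by simp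
  \<comment> \<open>Matrix powers grow by a factor on the right, whereas replacing a column by its
    image under \<open>M\<close> multiplies on the left.\<close>
  have comm: "M ^\<^sub>m k * M = M * M ^\<^sub>m k" for k
  proof (induction k)
    case (Suc k)
    have "M ^\<^sub>m Suc k * M = M * M ^\<^sub>m k * M" using Suc.IH by simp
    also have "\<dots> = M * M ^\<^sub>m Suc k" using assoc_mult_mat[OF M Mk M] by simp
    finally show ?case .
  qed (use M in simp)
  have step: "t * det (U k) = (\<Sum>l<n. det (U (k(l := Suc (k l)))))" for k
  proof -
    have "mat n n (\<lambda>(i, j). if j = l then (M * U k) $$ (i, j) else U k $$ (i, j)) =
      U (k(l := Suc (k l)))" for l
    proof (rule eq_matI)
      fix i j assume "i < dim_row (U (k(l := Suc (k l))))" "j < dim_col (U (k(l := Suc (k l))))"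
      then have ij: "i < n" "j < n" by (auto simp: U_def)
      have "(M * U k) $$ (i, j) = (M * M ^\<^sub>m k j) $$ (i, j)"
        unfolding index_mult_mat_sum[OF M U ij] index_mult_mat_sum[OF M Mk ij]
        using ij by (intro sum.cong) (auto simp: U_def)
      also have "M * M ^\<^sub>m k j = M ^\<^sub>m Suc (k j)"
        using comm[of "k j"] by simp
      finally have entry: "(M * U k) $$ (i, j) = (M ^\<^sub>m Suc (k j)) $$ (i, j)" .
      have "U (k(l := Suc (k l))) $$ (i, j) =
          (if j = l then (M * U k) $$ (i, j) else U k $$ (i, j))"
        unfolding entry using ij by (simp add: U_def)
      then show "mat n n (\<lambda>(i, j). if j = l then (M * U k) $$ (i, j) else U k $$ (i, j)) $$ (i, j) =
          U (k(l := Suc (k l))) $$ (i, j)"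
        using ij by simp
    qed (auto simp: U_def)
    then show ?thesis
      using sum_det_replace_col_mult[OF M U[of k]] by (simp add: t_def)
  qed
  \<comment> \<open>Scaling \<open>U k\<close> by \<open>m\<close> makes all entries integers and
    multiplies the determinant by \<open>m ^ n\<close>, so one factor serves every \<open>k\<close>.
    The induction on \<open>s\<close> trades a factor \<open>t\<close> for raising one exponent in
    \<open>k\<close>.\<close>
  have "of_int (m ^ n) * (t ^ s * det (U k)) \<in> \<int>" for s k
  proof (induction s arbitrary: k)
    case 0
    have "det (of_int m \<cdot>\<^sub>m U k) \<in> \<int>"
      by (rule det_Ints[of _ n]) (use U int in \<open>auto simp: U_def\<close>)
    then show ?case using U[of k] by (simp add: det_smult)
  next
    case (Suc s)
    have "of_int (m ^ n) * (t ^ Suc s * det (U k)) = of_int (m ^ n) * (t ^ s * (t * det (U k)))"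
      by simp
    also have "\<dots> = (\<Sum>l<n. of_int (m ^ n) * (t ^ s * det (U (k(l := Suc (k l))))))"
      unfolding step by (simp add: sum_distrib_left)
    also have "\<dots> \<in> \<int>" by (intro Ints_sum Suc.IH)
    finally show ?case .
  qed
  moreover have "U (\<lambda>_. 0) = 1\<^sub>m n" using M by (auto simp: U_def intro!: eq_matI)
  ultimately have "of_int (m ^ n) * t ^ s \<in> \<int>" for s
    by (metis det_one mult.right_neutral)
  then show ?thesis
    unfolding t_def[symmetric] by (rule rat_Ints_if_powers_bounded_denominator[rotated]) (use m in simp)
qed

section \<open>Scaled idempotent matrices of trace zero\<close>

text \<open>Each diagonal entry is 0 or \<open>c\<close>, so the trace counts the entries equal to
  \<open>c\<close>; in characteristic 0 a vanishing trace leaves a zero diagonal. Then the relation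
  \<open>B * B = c B\<close> clears one superdiagonal after another.\<close>

lemma upper_triangular_scaled_idempotent_eq_0:
  fixes B :: "complex mat"
  assumes B: "B \<in> carrier_mat n n" and upper: "upper_triangular B"
    and idem: "B * B = c \<cdot>\<^sub>m B" and c: "c \<noteq> 0" and tr: "(\<Sum>i<n. B $$ (i, i)) = 0"
  shows "B = 0\<^sub>m n n"
proof -
  have entry: "c * B $$ (i, j) = (\<Sum>k<n. B $$ (i, k) * B $$ (k, j))" if "i < n" "j < n" for i j
  proof -
    have "(c \<cdot>\<^sub>m B) $$ (i, j) = (B * B) $$ (i, j)" by (simp add: idem)
    then show ?thesis using that B by (auto simp: scalar_prod_def lessThan_atLeast0)
  qed
  have low: "B $$ (i, j) = 0" if "j < i" "i < n" for i j
    using upper B that by auto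
  have diag: "B $$ (i, i) = 0 \<or> B $$ (i, i) = c" if i: "i < n" for i
  proof -
    have "c * B $$ (i, i) = (\<Sum>k<n. if k = i then B $$ (i, i) * B $$ (i, i) else 0)"
      unfolding entry[OF i i]
      by (intro sum.cong refl) (use low i in \<open>force simp: nat_neq_iff\<close>)
    then show ?thesis using i by auto
  qed
  have "(\<Sum>i<n. B $$ (i, i)) = (\<Sum>i<n. if B $$ (i, i) = c then c else 0)"
    using diag c by (intro sum.cong) auto
  also have "\<dots> = of_nat (card {i. i < n \<and> B $$ (i, i) = c}) * c"
    by (simp add: sum.If_cases lessThan_def Collect_conj_eq)
  finally have "{i. i < n \<and> B $$ (i, i) = c} = {}" using tr c by simp
  then have diag0: "B $$ (i, i) = 0" if "i < n" for i using diag that by blast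
  \<comment> \<open>In each product of the entries at \<open>(i, k)\<close> and
    \<open>(k, j)\<close> with \<open>j \<le> i + Suc d\<close>, either \<open>k \<le> i + d\<close>
    or \<open>j \<le> k\<close>, so one factor lies in the region already known to vanish.\<close>
  have "\<forall>i j. i < n \<longrightarrow> j < n \<longrightarrow> j \<le> i + d \<longrightarrow> B $$ (i, j) = 0" for d
  proof (induction d)
    case 0
    then show ?case using low diag0 by (metis add.right_neutral le_neq_implies_less)
  next
    case (Suc d)
    have "B $$ (i, j) = 0" if ij: "i < n" "j < n" "j \<le> i + Suc d" for i j
    proof -
      have "B $$ (i, k) * B $$ (k, j) = 0" if "k < n" for k
        using Suc.IH ij that by (cases "k \<le> i + d") (auto simp: not_le)
      then have "(\<Sum>k<n. B $$ (i, k) * B $$ (k, j)) = 0" by (intro sum.neutral) simp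
      then show ?thesis using entry[OF ij(1,2)] c by simp
    qed
    then show ?case by blast
  qed
  then have "B $$ (i, j) = 0" if "i < n" "j < n" for i j using that by (meson le_add2 less_imp_le_nat order_trans)
  then show ?thesis using B by (auto intro!: eq_matI)
qed

text \<open>Over the complex numbers the characteristic polynomial splits, so \<open>M\<close> is
  similar to an upper triangular matrix. Similarity preserves the quadratic relation and the trace,
  which reduces the claim to the triangular case.\<close>

lemma scaled_idempotent_trace_0:
  fixes M :: "rat mat"
  assumes M: "M \<in> carrier_mat n n" and idem: "M * M = c \<cdot>\<^sub>m M" and c: "c \<noteq> 0"
    and tr: "(\<Sum>i<n. M $$ (i, i)) = 0"
  shows "M = 0\<^sub>m n n"
proof -
  let ?h = "of_rat :: rat \<Rightarrow> complex"
  have h: "semiring_hom ?h" by unfold_locales (auto simp: of_rat_add of_rat_mult)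
  let ?A = "map_mat ?h M"
  have A: "?A \<in> carrier_mat n n" using M by simp
  obtain B where B: "B \<in> carrier_mat n n" "upper_triangular B" "similar_mat ?A B"
    using char_poly_factorized[OF A] schur_decomposition_exists[OF A] by blast
  then obtain P Q where "similar_mat_wit ?A B P Q" by (auto simp: similar_mat_def)
  from similar_mat_witD2[OF A this]
  have PQ: "P * Q = 1\<^sub>m n" "Q * P = 1\<^sub>m n" "?A = P * B * Q"
    "P \<in> carrier_mat n n" "Q \<in> carrier_mat n n" by auto
  have B_eq: "B = Q * ?A * P"
  proof -
    have "Q * ?A * P = (Q * P) * B * (Q * P)" unfolding PQ(3) using PQ(4,5) B(1)
      by (simp add: assoc_mult_mat[of _ n n _ n _ n])
    then show ?thesis using B(1) PQ by simp
  qed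
  have AA: "?A * ?A = ?h c \<cdot>\<^sub>m ?A"
  proof -
    have "map_mat ?h (c \<cdot>\<^sub>m M) = ?h c \<cdot>\<^sub>m ?A" by (auto simp: of_rat_mult)
    then show ?thesis using semiring_hom.mat_hom_mult[OF h M M] by (simp add: idem)
  qed
  have "B * B = Q * ?A * (P * Q) * ?A * P"
    unfolding B_eq using PQ(4,5) A by (simp add: assoc_mult_mat[of _ n n _ n _ n])
  also have "\<dots> = Q * (?A * ?A) * P" using PQ A by (simp add: assoc_mult_mat[of _ n n _ n _ n])
  also have "\<dots> = ?h c \<cdot>\<^sub>m B" unfolding AA B_eq using PQ A
    by (simp add: mult_smult_distrib[of _ n n _ n] mult_smult_assoc_mat[of _ n n _ n])
  finally have BB: "B * B = ?h c \<cdot>\<^sub>m B" .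
  have trc: "(\<Sum>i<n. (C * D) $$ (i, i)) = (\<Sum>i<n. (D * C) $$ (i, i))"
    if "C \<in> carrier_mat n n" "D \<in> carrier_mat n n" for C D :: "complex mat"
  proof -
    have "(\<Sum>i<n. (C * D) $$ (i, i)) = (\<Sum>i<n. \<Sum>k<n. C $$ (i, k) * D $$ (k, i))"
      using that by (intro sum.cong) (auto simp: scalar_prod_def lessThan_atLeast0)
    also have "\<dots> = (\<Sum>i<n. \<Sum>k<n. D $$ (i, k) * C $$ (k, i))"
      by (subst sum.swap) (simp add: mult.commute)
    also have "\<dots> = (\<Sum>i<n. (D * C) $$ (i, i))"
      using that by (intro sum.cong) (auto simp: scalar_prod_def lessThan_atLeast0)
    finally show ?thesis .
  qed
  have "(\<Sum>i<n. B $$ (i, i)) = (\<Sum>i<n. (P * (Q * ?A)) $$ (i, i))"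
    unfolding B_eq using PQ A by (intro trc) auto
  also have "P * (Q * ?A) = ?A"
    using PQ(1,4,5) A by (simp add: assoc_mult_mat[of P n n Q n ?A n, symmetric])
  also have "(\<Sum>i<n. ?A $$ (i, i)) = ?h (\<Sum>i<n. M $$ (i, i))"
    using M by (simp add: of_rat_sum)
  finally have "(\<Sum>i<n. B $$ (i, i)) = 0" using tr by simp
  from upper_triangular_scaled_idempotent_eq_0[OF B(1,2) BB _ this] c have "B = 0\<^sub>m n n" by simp
  then have "?A = 0\<^sub>m n n" using PQ by simp
  then have "?h (M $$ (i, j)) = 0" if "i < n" "j < n" for i j
    using that M by (metis index_map_mat(1) carrier_matD index_zero_mat(1))
  then show ?thesis using M by (auto intro!: eq_matI)
qed

section \<open>Denominators from a nondegenerate integer matrix\<close>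

text \<open>The witness is the determinant of \<open>G\<close>: if it were 0, there would be a
  nonzero integer kernel vector. The adjugate then writes \<open>d * c j\<close> as an integer
  combination of the entries of \<open>G c\<close>.\<close>

lemma nondegenerate_imp_bounded_denominator:
  fixes G :: "nat \<Rightarrow> nat \<Rightarrow> int"
  assumes nondeg: "\<And>v :: nat \<Rightarrow> int. \<forall>i<n. (\<Sum>j<n. G i j * v j) = 0 \<Longrightarrow> \<forall>j<n. v j = 0"
  shows "\<exists>d \<noteq> 0. \<forall>c :: nat \<Rightarrow> rat. (\<forall>i<n. (\<Sum>j<n. of_int (G i j) * c j) \<in> \<int>) \<longrightarrow>
    (\<forall>j<n. of_int d * c j \<in> \<int>)"
proof (intro exI conjI allI impI)
  let ?M = "mat n n (\<lambda>(i, j). G i j)"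
  let ?d = "det ?M"
  let ?h = "of_int :: int \<Rightarrow> rat"
  have M: "?M \<in> carrier_mat n n" by simp
  show "?d \<noteq> 0"
  proof
    assume "?d = 0"
    then obtain v where v: "v \<in> carrier_vec n" "v \<noteq> 0\<^sub>v n" "?M *\<^sub>v v = 0\<^sub>v n"
      using det_0_iff_vec_prod_zero[OF M] by blast
    have "(\<Sum>j<n. G i j * v $ j) = 0" if "i < n" for i
    proof -
      have "(?M *\<^sub>v v) $ i = 0" using v(3) that by simp
      then show ?thesis using that v(1) by (auto simp: scalar_prod_def lessThan_atLeast0)
    qed
    then have "v $ j = 0" if "j < n" for j using nondeg[of "\<lambda>j. v $ j"] that by blast
    then have "v = 0\<^sub>v n" using v(1) by (auto intro!: eq_vecI)
    then show False using v(2) by simp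
  qed
  fix c :: "nat \<Rightarrow> rat" and j
  assume c: "\<forall>i<n. (\<Sum>j<n. ?h (G i j) * c j) \<in> \<int>" and j: "j < n"
  have adj: "adj_mat ?M \<in> carrier_mat n n" "adj_mat ?M * ?M = ?d \<cdot>\<^sub>m 1\<^sub>m n"
    using adj_mat[OF M] by auto
  have inv: "(\<Sum>i<n. adj_mat ?M $$ (j, i) * G i k) = (if j = k then ?d else 0)" if "k < n" for k
  proof -
    have "(adj_mat ?M * ?M) $$ (j, k) = (if j = k then ?d else 0)" using adj(2) that j by simp
    then show ?thesis using that j adj(1) by (auto simp: scalar_prod_def lessThan_atLeast0)
  qed
  have "?h ?d * c j = (\<Sum>k<n. ?h (if j = k then ?d else 0) * c k)"
  proof -
    have "(\<Sum>k<n. ?h (if j = k then ?d else 0) * c k) = (\<Sum>k<n. if k = j then ?h ?d * c j else 0)"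
      by (intro sum.cong) auto
    then show ?thesis using j by simp
  qed
  also have "\<dots> = (\<Sum>k<n. \<Sum>i<n. ?h (adj_mat ?M $$ (j, i)) * (?h (G i k) * c k))"
  proof (intro sum.cong refl)
    fix k assume "k \<in> {..<n}"
    then have "?h (if j = k then ?d else 0) * c k = ?h (\<Sum>i<n. adj_mat ?M $$ (j, i) * G i k) * c k"
      using inv by simp
    then show "?h (if j = k then ?d else 0) * c k =
        (\<Sum>i<n. ?h (adj_mat ?M $$ (j, i)) * (?h (G i k) * c k))"
      by (simp add: sum_distrib_right mult.assoc)
  qed
  also have "\<dots> = (\<Sum>i<n. ?h (adj_mat ?M $$ (j, i)) * (\<Sum>k<n. ?h (G i k) * c k))"
    by (subst sum.swap) (simp add: sum_distrib_left)
  also have "\<dots> \<in> \<int>" by (rule Ints_sum, rule Ints_mult[OF Ints_of_int]) (use c in simp)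
  finally show "?h ?d * c j \<in> \<int>" .
qed

section \<open>Subgroups of free abelian groups\<close>

text \<open>Submodules over the integers are the subgroups, so \<open>frag.subspace\<close> and
  \<open>frag.span\<close> express subgroups and the subgroups generated by sets.\<close>

interpretation frag: Modules.module frag_cmul
  by unfold_locales (auto simp: frag_cmul_distrib frag_cmul_distrib2)

text \<open>Induction on the rank. The last coordinates of elements of \<open>G\<close> form an
  ideal of the integers; an element \<open>g0\<close> whose last coordinate has least nonzero
  absolute value generates it by division with remainder, and the remainders lie in
  \<open>G'\<close>, which has rank smaller by one.\<close>

lemma finitely_generated_frag_subspace:
  fixes G :: "(nat \<Rightarrow>\<^sub>0 int) set"
  assumes "frag.subspace G" and "\<And>g. g \<in> G \<Longrightarrow> Poly_Mapping.keys g \<subseteq> {..<n}"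
  obtains C where "finite C" "C \<subseteq> G" "G = frag.span C"
  using assms
proof (induction n arbitrary: G thesis)
  case 0
  then have "G = {0}" using frag.subspace_0[of G] by force
  then show ?case by (intro "0.prems"(1)[of "{}"]) auto
next
  case (Suc n)
  let ?l = "\<lambda>g. Poly_Mapping.lookup g n"
  define G' where "G' = {g \<in> G. ?l g = 0}"
  have sub': "frag.subspace G'"
    using Suc.prems(2) unfolding frag.subspace_def G'_def by (auto simp: lookup_add)
  have keys': "Poly_Mapping.keys g \<subseteq> {..<n}" if "g \<in> G'" for g
  proof
    fix k assume k: "k \<in> Poly_Mapping.keys g"
    then have "k < Suc n" using Suc.prems(3) that by (auto simp: G'_def)
    moreover have "k \<noteq> n" using k that by (auto simp: G'_def in_keys_iff)
    ultimately show "k \<in> {..<n}" by simp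
  qed
  obtain C' where C': "finite C'" "C' \<subseteq> G'" "G' = frag.span C'"
    using Suc.IH[OF _ sub' keys'] by blast
  show ?case
  proof (cases "G = G'")
    case True
    then show ?thesis using C' Suc.prems(1) by blast
  next
    case False
    then obtain g1 where g1: "g1 \<in> G" "?l g1 \<noteq> 0" by (auto simp: G'_def)
    obtain g0 where g0: "g0 \<in> G" "?l g0 \<noteq> 0"
      and min: "\<And>g. g \<in> G \<Longrightarrow> ?l g \<noteq> 0 \<Longrightarrow> nat \<bar>?l g0\<bar> \<le> nat \<bar>?l g\<bar>"
      using ex_has_least_nat[of "\<lambda>g. g \<in> G \<and> ?l g \<noteq> 0" g1 "\<lambda>g. nat \<bar>?l g\<bar>"] g1 by blast
    have "g \<in> frag.span (insert g0 C')" if g: "g \<in> G" for g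
    proof -
      let ?q = "?l g div ?l g0"
      let ?r = "g - frag_cmul ?q g0"
      have r: "?r \<in> G" using g g0(1) Suc.prems(2) by (simp add: frag.subspace_diff frag.subspace_scale)
      have lr: "?l ?r = ?l g mod ?l g0"
        by (simp add: lookup_minus minus_div_mult_eq_mod)
      have "\<bar>?l g mod ?l g0\<bar> < \<bar>?l g0\<bar>" using g0(2) by (rule abs_mod_less)
      then have "?l ?r = 0" using min[OF r] lr by force
      then have "?r \<in> G'" using r by (simp add: G'_def)
      then show ?thesis using C'(3) by (auto simp: frag.span_insert)
    qed
    moreover have "insert g0 C' \<subseteq> G" using C'(2) g0(1) by (auto simp: G'_def)
    then have "frag.span (insert g0 C') \<subseteq> G" using Suc.prems(2) by (rule frag.span_minimal)
    ultimately show ?thesis using C' \<open>insert g0 C' \<subseteq> G\<close>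
      by (intro Suc.prems(1)[of "insert g0 C'"]) auto
  qed
qed

text \<open>This is the ascending chain condition: the span of the whole sequence is finitely
  generated, and the finitely many generators already lie in the span of an initial segment, as must
  the next term.\<close>

lemma frag_sequence_dependent:
  fixes v :: "nat \<Rightarrow> (nat \<Rightarrow>\<^sub>0 int)"
  assumes "\<And>k. Poly_Mapping.keys (v k) \<subseteq> {..<n}"
  obtains N where "v N \<in> frag.span (v ` {..<N})"
proof -
  have "frag.subspace {c. Poly_Mapping.keys c \<subseteq> {..<n}}"
    by (auto simp: frag.subspace_def dest!: subsetD[OF keys_add])
  then have "frag.span (range v) \<subseteq> {c. Poly_Mapping.keys c \<subseteq> {..<n}}"
    using assms by (intro frag.span_minimal) auto
  then have keys: "Poly_Mapping.keys g \<subseteq> {..<n}" if "g \<in> frag.span (range v)" for g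
    using that by auto
  obtain C where C: "finite C" "C \<subseteq> frag.span (range v)" "frag.span (range v) = frag.span C"
    by (rule finitely_generated_frag_subspace[OF frag.subspace_span keys])
  have mono: "frag.span (v ` {..<a}) \<subseteq> frag.span (v ` {..<b})" if "a \<le> b" for a b
    using that by (intro frag.span_mono) auto
  have "\<exists>N. c \<in> frag.span (v ` {..<N})" if "c \<in> frag.span (range v)" for c
    using that
  proof (induction rule: frag.span_induct_alt)
    case base
    then show ?case using frag.span_zero by blast
  next
    case (step c x y)
    then obtain j N where j: "x = v j" and N: "y \<in> frag.span (v ` {..<N})" by auto
    have "x \<in> frag.span (v ` {..<max N (Suc j)})" using j by (intro frag.span_base) auto
    moreover have "y \<in> frag.span (v ` {..<max N (Suc j)})" using mono[of N "max N (Suc j)"] N by auto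
    ultimately show ?case by (meson frag.span_add frag.span_scale)
  qed
  then obtain N where N: "\<And>c. c \<in> C \<Longrightarrow> c \<in> frag.span (v ` {..<N c})"
    using C(2) by (metis subsetD)
  \<comment> \<open>The inserted 0 keeps the maximum defined when \<open>C\<close> is empty.\<close>
  let ?M = "Max (insert 0 (N ` C))"
  have "N c \<le> ?M" if "c \<in> C" for c using C(1) that by simp
  then have "C \<subseteq> frag.span (v ` {..<?M})" using N mono by blast
  then have "frag.span C \<subseteq> frag.span (v ` {..<?M})" by (intro frag.span_minimal) auto
  moreover have "v ?M \<in> frag.span C" using C(3) frag.span_base[of "v ?M" "range v"] by simp
  ultimately show ?thesis using that by blast
qed

section \<open>Integer polynomials evaluated in a commutative ring\<close>

context cring
begin

text \<open>The canonical ring homomorphism from the integers. Integer multiples are rewritten as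
  products with its values, so that ring arithmetic applies to them.\<close>

definition int_embed :: "int \<Rightarrow> 'a" where
  "int_embed k = [k] \<cdot>\<^bsub>R\<^esub> \<one>"

lemma int_embed_closed [simp]: "int_embed k \<in> carrier R"
  by (simp add: int_embed_def)

lemma int_embed_add: "int_embed (a + b) = int_embed a \<oplus> int_embed b"
  by (simp add: int_embed_def add.int_pow_mult)

lemma int_smult_eq: "x \<in> carrier R \<Longrightarrow> [(k :: int)] \<cdot>\<^bsub>R\<^esub> x = int_embed k \<otimes> x"
  using add_pow_ldistr_int[of \<one> x k] by (simp add: int_embed_def)

lemma nat_smult_eq: "x \<in> carrier R \<Longrightarrow> [(k :: nat)] \<cdot>\<^bsub>R\<^esub> x = int_embed (int k) \<otimes> x"
  using int_smult_eq[of x "int k"] by (simp add: add_pow_int_ge)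

lemma int_embed_0 [simp]: "int_embed 0 = \<zero>"
  by (simp add: int_embed_def add_pow_def)

lemma int_embed_1 [simp]: "int_embed 1 = \<one>"
  by (simp add: int_embed_def)

lemma int_embed_minus: "int_embed (- k) = \<ominus> int_embed k"
  by (simp add: int_embed_def add.int_pow_neg)

lemma int_embed_mult: "int_embed (a * b) = int_embed a \<otimes> int_embed b"
proof -
  have "int_embed (a * b) = [a] \<cdot>\<^bsub>R\<^esub> ([b] \<cdot>\<^bsub>R\<^esub> \<one>)"
    by (simp add: int_embed_def add.int_pow_pow mult.commute)
  then show ?thesis by (simp add: int_smult_eq)
qed

definition int_poly_eval :: "int poly \<Rightarrow> 'a \<Rightarrow> 'a" where
  "int_poly_eval p x = (\<Oplus> i \<in> {..Polynomial.degree p}. [Polynomial.coeff p i] \<cdot>\<^bsub>R\<^esub> (x [^] i))"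

text \<open>The free upper bound \<open>N\<close> lets polynomials of different degrees be summed
  over a common index range.\<close>

lemma int_poly_eval_eq:
  assumes x: "x \<in> carrier R" and N: "Polynomial.degree p \<le> N"
  shows "int_poly_eval p x = (\<Oplus> i \<in> {..N}. int_embed (Polynomial.coeff p i) \<otimes> x [^] i)"
  unfolding int_poly_eval_def using x N
  by (intro add.finprod_mono_neutral_cong_left) (auto simp: int_smult_eq coeff_eq_0)

lemma int_poly_eval_closed [simp]: "x \<in> carrier R \<Longrightarrow> int_poly_eval p x \<in> carrier R"
  by (simp add: int_poly_eval_eq[OF _ order_refl])

lemma int_poly_eval_0 [simp]: "x \<in> carrier R \<Longrightarrow> int_poly_eval 0 x = \<zero>"
  by (simp add: int_poly_eval_def add_pow_def)

lemma int_poly_eval_pCons: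
  assumes x: "x \<in> carrier R"
  shows "int_poly_eval (pCons a p) x = int_embed a \<oplus> x \<otimes> int_poly_eval p x"
proof -
  have "int_poly_eval (pCons a p) x =
      (\<Oplus> i \<in> {..Suc (Polynomial.degree p)}. int_embed (Polynomial.coeff (pCons a p) i) \<otimes> x [^] i)"
    by (intro int_poly_eval_eq x degree_pCons_le)
  also have "\<dots> = (\<Oplus> i \<in> {..Polynomial.degree p}. int_embed (Polynomial.coeff p i) \<otimes> x [^] Suc i) \<oplus> int_embed a"
    using x by (subst add.finprod_Suc2) auto
  also have "(\<Oplus> i \<in> {..Polynomial.degree p}. int_embed (Polynomial.coeff p i) \<otimes> x [^] Suc i) =
      (\<Oplus> i \<in> {..Polynomial.degree p}. x \<otimes> (int_embed (Polynomial.coeff p i) \<otimes> x [^] i))"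
    using x by (intro add.finprod_cong) (auto simp: m_ac simp_implies_def)
  also have "\<dots> = x \<otimes> int_poly_eval p x"
    using x by (simp add: int_poly_eval_eq[OF x order_refl] finsum_rdistr)
  finally show ?thesis using x by (simp add: a_comm)
qed

lemma int_poly_eval_add:
  assumes x: "x \<in> carrier R"
  shows "int_poly_eval (p + q) x = int_poly_eval p x \<oplus> int_poly_eval q x"
proof -
  let ?N = "max (Polynomial.degree p) (Polynomial.degree q)"
  have "int_poly_eval (p + q) x = (\<Oplus> i \<in> {..?N}. int_embed (Polynomial.coeff (p + q) i) \<otimes> x [^] i)"
    by (intro int_poly_eval_eq x degree_add_le) auto
  also have "\<dots> = (\<Oplus> i \<in> {..?N}. int_embed (Polynomial.coeff p i) \<otimes> x [^] i \<oplus> int_embed (Polynomial.coeff q i) \<otimes> x [^] i)"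
    using x by (intro add.finprod_cong) (auto simp: int_embed_add l_distr simp_implies_def)
  finally show ?thesis
    using x int_poly_eval_eq[OF x, of p ?N] int_poly_eval_eq[OF x, of q ?N] by simp
qed

lemma int_poly_eval_smult:
  assumes x: "x \<in> carrier R"
  shows "int_poly_eval (smult c p) x = int_embed c \<otimes> int_poly_eval p x"
proof -
  have "int_poly_eval (smult c p) x = (\<Oplus> i \<in> {..Polynomial.degree p}. int_embed (Polynomial.coeff (smult c p) i) \<otimes> x [^] i)"
    by (intro int_poly_eval_eq x degree_smult_le)
  also have "\<dots> = (\<Oplus> i \<in> {..Polynomial.degree p}. int_embed c \<otimes> (int_embed (Polynomial.coeff p i) \<otimes> x [^] i))"
    using x by (intro add.finprod_cong) (auto simp: int_embed_mult m_assoc simp_implies_def)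
  finally show ?thesis using x by (simp add: int_poly_eval_eq[OF x order_refl] finsum_rdistr)
qed

lemma int_poly_eval_monom:
  assumes x: "x \<in> carrier R"
  shows "int_poly_eval (Polynomial.monom 1 k) x = x [^] k"
proof (induction k)
  case 0
  then show ?case using x by (simp add: int_poly_eval_pCons monom_0)
next
  case (Suc k)
  then show ?case using x by (simp add: int_poly_eval_pCons monom_Suc m_comm)
qed

lemma int_poly_eval_diff:
  assumes x: "x \<in> carrier R"
  shows "int_poly_eval (p - q) x = int_poly_eval p x \<ominus> int_poly_eval q x"
proof -
  have "p - q = p + smult (-1) q" by simp
  then have "int_poly_eval (p - q) x = int_poly_eval (p + smult (-1) q) x" by (rule arg_cong)
  also have "\<dots> = int_poly_eval p x \<oplus> int_embed (-1) \<otimes> int_poly_eval q x"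
    by (simp only: int_poly_eval_add[OF x] int_poly_eval_smult[OF x])
  finally show ?thesis using x int_embed_minus[of 1] by (simp add: minus_eq l_minus)
qed

lemma int_poly_eval_monom_mult:
  assumes x: "x \<in> carrier R"
  shows "int_poly_eval (Polynomial.monom 1 k * p) x = x [^] k \<otimes> int_poly_eval p x"
proof (induction k)
  case 0
  then show ?case using x by (simp add: monom_0)
next
  case (Suc k)
  then show ?case using x by (simp add: int_poly_eval_pCons monom_Suc m_ac)
qed

lemma maximal_order_iff:
  "x \<in> maximal_order R \<longleftrightarrow> x \<in> carrier R \<and> (\<exists>p. Polynomial.coeff p (Polynomial.degree p) = 1 \<and> int_poly_eval p x = \<zero>)"
  by (simp add: maximal_order_def int_poly_eval_def)

end

section \<open>Integrality and denominators\<close>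

text \<open>
  The map \<open>\<phi>\<close> identifies \<open>R\<close> with \<open>\<int>\<^sup>n\<close>, the finitely supported functions that vanish outside
  \<open>{..<n}\<close>.
\<close>

locale order_basis = cring K
  for K :: "('a, 'm) ring_scheme" (structure)
  + fixes R :: "'a set" and n :: nat and \<phi> :: "'a \<Rightarrow> (nat \<Rightarrow>\<^sub>0 int)"
  assumes order: "order_in R K"
    and \<phi>_add: "r \<in> R \<Longrightarrow> s \<in> R \<Longrightarrow> \<phi> (r \<oplus> s) = \<phi> r + \<phi> s"
    and \<phi>_inj: "inj_on \<phi> R"
    and \<phi>_image: "\<phi> ` R = {c. Poly_Mapping.keys c \<subseteq> {..<n}}"
begin

lemma R_subring: "subring R K"
  using order by (simp add: order_in_def total_quotient_ring_def)

lemma R_closed [simp]: "r \<in> R \<Longrightarrow> r \<in> carrier K"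
  and R_zero [simp]: "\<zero> \<in> R"
  and R_one [simp]: "\<one> \<in> R"
  and R_add [simp]: "r \<in> R \<Longrightarrow> s \<in> R \<Longrightarrow> r \<oplus> s \<in> R"
  and R_mult [simp]: "r \<in> R \<Longrightarrow> s \<in> R \<Longrightarrow> r \<otimes> s \<in> R"
  and R_minus [simp]: "r \<in> R \<Longrightarrow> \<ominus> r \<in> R"
  using subringE[OF R_subring] by auto

lemma R_pow [simp]: "r \<in> R \<Longrightarrow> r [^] (k :: nat) \<in> R"
  by (induction k) auto

lemma R_finsum: "finite A \<Longrightarrow> f \<in> A \<rightarrow> R \<Longrightarrow> finsum K f A \<in> R"
proof (induction A rule: finite_induct)
  case (insert a A)
  then have "f a \<in> carrier K" "f \<in> A \<rightarrow> carrier K" using R_closed by (auto simp: Pi_iff)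
  then show ?case using insert by auto
qed simp

lemma int_embed_R [simp]: "int_embed k \<in> R"
proof (induction k rule: int_induct[where k = 0])
  case (step1 i)
  then show ?case by (simp add: int_embed_add)
next
  case (step2 i)
  then show ?case using int_embed_add[of i "- 1"] int_embed_minus[of 1] by simp
qed simp

lemma reduced_R: "r \<in> R \<Longrightarrow> r \<otimes> r = \<zero> \<Longrightarrow> r = \<zero>"
proof -
  assume r: "r \<in> R" "r \<otimes> r = \<zero>"
  have "r [^]\<^bsub>K\<lparr>carrier := R\<rparr>\<^esub> (2 :: nat) = \<zero>\<^bsub>K\<lparr>carrier := R\<rparr>\<^esub>"
    using r by (simp add: nat_pow_def numeral_2_eq_2)
  moreover have "reduced (K\<lparr>carrier := R\<rparr>)"
    using order by (simp add: order_in_def is_order_def)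
  ultimately show "r = \<zero>" using r unfolding reduced_def by fastforce
qed

lemma total_quotientE:
  assumes "x \<in> carrier K"
  obtains a b where "a \<in> R" "b \<in> R" "b \<in> Units K" "x = a \<otimes> inv b"
    "\<And>r. r \<in> R \<Longrightarrow> b \<otimes> r = \<zero> \<Longrightarrow> r = \<zero>"
proof -
  obtain a b where "a \<in> R" "non_zero_divisor (K\<lparr>carrier := R\<rparr>) b" "x = a \<otimes> inv b"
    using assms order unfolding order_in_def total_quotient_ring_def by metis
  moreover from this have "b \<in> Units K"
    using order unfolding order_in_def total_quotient_ring_def by simp
  ultimately show ?thesis by (intro that) (auto simp: non_zero_divisor_def)
qed

lemma \<phi>_zero: "\<phi> \<zero> = 0"
  using \<phi>_add[of \<zero> \<zero>] by simp

lemma \<phi>_minus: "r \<in> R \<Longrightarrow> \<phi> (\<ominus> r) = - \<phi> r"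
  using \<phi>_add[of r "\<ominus> r"] by (simp add: r_neg \<phi>_zero eq_neg_iff_add_eq_0 add.commute)

lemma \<phi>_int: "r \<in> R \<Longrightarrow> \<phi> (int_embed k \<otimes> r) = frag_cmul k (\<phi> r)"
proof (induction k rule: int_induct[where k = 0])
  case base
  then show ?case by (simp add: \<phi>_zero)
next
  case (step1 i)
  then show ?case by (simp add: int_embed_add l_distr \<phi>_add frag_cmul_distrib)
next
  case (step2 i)
  then show ?case
    using int_embed_add[of i "- 1"] int_embed_minus[of 1]
    by (simp add: l_distr l_minus \<phi>_add \<phi>_minus frag_cmul_diff_distrib)
qed

lemma keys_\<phi>: "r \<in> R \<Longrightarrow> Poly_Mapping.keys (\<phi> r) \<subseteq> {..<n}"
  using \<phi>_image by blast

text \<open>Multiplying by the denominator \<open>b\<close> of \<open>x\<close> moves the relation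
  into \<open>R\<close>, which \<open>\<phi>\<close> embeds into a torsion-free group.\<close>

lemma torsion_free:
  assumes x: "x \<in> carrier K" and k: "k \<noteq> 0" and 0: "int_embed k \<otimes> x = \<zero>"
  shows "x = \<zero>"
proof -
  obtain a b where ab: "a \<in> R" "b \<in> R" "b \<in> Units K" "x = a \<otimes> inv b"
    using total_quotientE[OF x] by blast
  have "int_embed k \<otimes> a = int_embed k \<otimes> x \<otimes> b"
    using ab by (simp add: m_assoc)
  then have "int_embed k \<otimes> a = \<zero>" using ab 0 by simp
  then have "frag_cmul k (\<phi> a) = 0" using \<phi>_int[OF ab(1), of k] by (simp add: \<phi>_zero)
  then have "\<phi> a = \<phi> \<zero>" using k by (simp add: \<phi>_zero)
  then have "a = \<zero>" by (rule inj_onD[OF \<phi>_inj]) (use ab in auto)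
  then show ?thesis using ab by simp
qed

lemma torsion_free_cancel:
  assumes "x \<in> carrier K" "y \<in> carrier K" "k \<noteq> 0" "int_embed k \<otimes> x = int_embed k \<otimes> y"
  shows "x = y"
proof -
  have "int_embed k \<otimes> (x \<ominus> y) = \<zero>" using assms by (simp add: minus_eq r_distr r_minus r_neg)
  then have "x \<ominus> y = \<zero>" using torsion_free assms by simp
  then show ?thesis using assms by simp
qed

text \<open>Only the exponents up to the degree are constrained, so that the lemma can be fed with
  the hypothesis of a strong induction on powers of \<open>x\<close>.\<close>

lemma int_poly_eval_R:
  assumes x: "x \<in> carrier K"
    and pow: "\<And>i. i \<le> Polynomial.degree p \<Longrightarrow> int_embed m \<otimes> x [^] i \<in> R"
  shows "int_embed m \<otimes> int_poly_eval p x \<in> R"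
proof -
  have "int_embed m \<otimes> int_poly_eval p x =
      (\<Oplus> i \<in> {..Polynomial.degree p}. int_embed m \<otimes> (int_embed (Polynomial.coeff p i) \<otimes> x [^] i))"
    using x by (simp add: int_poly_eval_eq[OF x order_refl] finsum_rdistr)
  also have "\<dots> = (\<Oplus> i \<in> {..Polynomial.degree p}. int_embed (Polynomial.coeff p i) \<otimes> (int_embed m \<otimes> x [^] i))"
    using x by (intro add.finprod_cong) (auto simp: m_ac simp_implies_def)
  also have "\<dots> \<in> R" using pow by (intro R_finsum) auto
  finally show ?thesis .
qed

text \<open>The elements \<open>m x^k\<close> all lie in the lattice \<open>R\<close>, so some
  \<open>m x^N\<close> is an integer combination of earlier ones. Cancelling \<open>m\<close> in the
  torsion-free \<open>K\<close> leaves a monic equation of degree \<open>N\<close>.\<close>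

lemma maximal_orderI:
  assumes x: "x \<in> carrier K" and m: "m \<noteq> 0"
    and pow: "\<And>k :: nat. int_embed m \<otimes> x [^] k \<in> R"
  shows "x \<in> maximal_order K"
proof -
  let ?v = "\<lambda>k :: nat. \<phi> (int_embed m \<otimes> x [^] k)"
  let ?f = "\<lambda>p. \<phi> (int_embed m \<otimes> int_poly_eval p x)"
  obtain N where N: "?v N \<in> frag.span (?v ` {..<N})"
    by (rule frag_sequence_dependent[of ?v n]) (use keys_\<phi>[OF pow] in auto)
  \<comment> \<open>Polynomials of degree below \<open>N\<close>, described by coefficients so that
    for \<open>N = 0\<close> only the zero polynomial remains.\<close>
  define P where "P = {p :: int poly. \<forall>i \<ge> N. Polynomial.coeff p i = 0}"
  have ev: "int_embed m \<otimes> int_poly_eval p x \<in> R" for p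
    using x pow by (rule int_poly_eval_R)
  have "frag.subspace (?f ` P)"
  proof (rule frag.subspaceI)
    show "0 \<in> ?f ` P"
      by (rule image_eqI[of _ _ 0]) (use x in \<open>auto simp: P_def \<phi>_zero\<close>)
    fix a b assume "a \<in> ?f ` P" "b \<in> ?f ` P"
    then obtain p q where pq: "a = ?f p" "b = ?f q" "p \<in> P" "q \<in> P" by blast
    have "a + b = ?f (p + q)"
      using x ev pq by (simp add: int_poly_eval_add r_distr \<phi>_add)
    moreover have "p + q \<in> P" using pq by (simp add: P_def)
    ultimately show "a + b \<in> ?f ` P" by blast
    fix c
    have "frag_cmul c a = \<phi> (int_embed c \<otimes> (int_embed m \<otimes> int_poly_eval p x))"
      using ev pq by (simp add: \<phi>_int)
    also have "\<dots> = ?f (smult c p)"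
      using x by (simp add: int_poly_eval_smult m_lcomm)
    finally have "frag_cmul c a = ?f (smult c p)" .
    moreover have "smult c p \<in> P" using pq by (simp add: P_def)
    ultimately show "frag_cmul c a \<in> ?f ` P" by blast
  qed
  moreover have "?v ` {..<N} \<subseteq> ?f ` P"
  proof
    fix w assume "w \<in> ?v ` {..<N}"
    then obtain j where j: "j < N" "w = ?f (Polynomial.monom 1 j)"
      using x by (auto simp: int_poly_eval_monom)
    moreover have "Polynomial.monom 1 j \<in> P" using j by (auto simp: P_def)
    ultimately show "w \<in> ?f ` P" by blast
  qed
  ultimately have "?v N \<in> ?f ` P" using N frag.span_minimal by blast
  then obtain p where p: "p \<in> P" "?v N = ?f p" by blast
  have "int_embed m \<otimes> x [^] N = int_embed m \<otimes> int_poly_eval p x"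
    using p(2) by (rule inj_onD[OF \<phi>_inj]) (rule pow ev)+
  then have eq: "x [^] N = int_poly_eval p x"
    using torsion_free_cancel x m by simp
  let ?q = "Polynomial.monom 1 N - p"
  have "Polynomial.degree ?q = N"
    using p by (intro antisym degree_le le_degree) (auto simp: P_def)
  then have "Polynomial.coeff ?q (Polynomial.degree ?q) = 1" using p by (simp add: P_def)
  moreover have "int_poly_eval ?q x = \<zero>"
    using x eq by (simp add: int_poly_eval_diff int_poly_eval_monom r_right_minus_eq)
  ultimately show ?thesis using x maximal_order_iff by blast
qed

lemma R_subset_maximal_order: "R \<subseteq> maximal_order K"
proof
  fix x assume "x \<in> R"
  then show "x \<in> maximal_order K" by (intro maximal_orderI[of x 1]) simp_all
qed

text \<open>
  Factors \<open>X\<close> can be cancelled from a polynomial annihilating \<open>z\<close> because \<open>R\<close> is reduced, until its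
  constant term \<open>c\<close> is nonzero. Then \<open>z y / c\<close> is the idempotent of \<open>K\<close> that generates \<open>z K\<close>.
\<close>

lemma quasi_regular:
  assumes z: "z \<in> R"
  obtains c y where "c \<noteq> 0" "y \<in> R" "int_embed c \<otimes> z = z \<otimes> z \<otimes> y"
proof -
  obtain p where p: "Polynomial.coeff p (Polynomial.degree p) = 1" "int_poly_eval p z = \<zero>"
    using z R_subset_maximal_order maximal_order_iff by blast
  have ev: "int_poly_eval p z \<in> R" for p
    using int_poly_eval_R[of z p 1] z by simp
  \<comment> \<open>The induction runs on \<open>z p(z) = 0\<close> instead of
    \<open>p(z) = 0\<close>. If \<open>p = X q\<close>, multiplying \<open>z z q(z) = 0\<close> by
    \<open>q(z)\<close> makes \<open>z q(z)\<close> square to zero, and reducedness returns the same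
    statement for \<open>q\<close>.\<close>
  have "p \<noteq> 0 \<Longrightarrow> z \<otimes> int_poly_eval p z = \<zero> \<Longrightarrow>
      \<exists>c y. c \<noteq> 0 \<and> y \<in> R \<and> int_embed c \<otimes> z = z \<otimes> z \<otimes> y" for p
  proof (induction p)
    case (pCons a p)
    let ?w = "int_poly_eval p z"
    have w: "?w \<in> R" by (rule ev)
    have eq: "int_embed a \<otimes> z \<oplus> z \<otimes> z \<otimes> ?w = \<zero>"
      using pCons.prems(2) z w by (simp add: int_poly_eval_pCons r_distr m_ac)
    show ?case
    proof (cases "a = 0")
      case True
      then have "z \<otimes> z \<otimes> ?w = \<zero>" using eq z w by simp
      then have "(z \<otimes> z \<otimes> ?w) \<otimes> ?w = \<zero>" using w by simp
      then have "(z \<otimes> ?w) \<otimes> (z \<otimes> ?w) = \<zero>" using z w by (simp add: m_ac)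
      then have "z \<otimes> ?w = \<zero>" using reduced_R[of "z \<otimes> ?w"] z w by simp
      then show ?thesis using pCons True by auto
    next
      case False
      have "int_embed a \<otimes> z = \<ominus> (z \<otimes> z \<otimes> ?w)"
        using minus_equality[OF eq] z w by simp
      then have "int_embed a \<otimes> z = z \<otimes> z \<otimes> \<ominus> ?w" using z w by (simp add: r_minus)
      then show ?thesis using False w R_minus by blast
    qed
  qed simp
  moreover have "p \<noteq> 0" using p(1) by auto
  ultimately show ?thesis using p(2) z that by (metis R_closed r_null)
qed

section \<open>Bounded denominators and integrality\<close>

text \<open>For a non-zero-divisor \<open>b\<close>, the relation \<open>c b = b b y\<close> cancels
  to \<open>c = b y\<close>. Thus \<open>y / c\<close> inverts \<open>b\<close>, and the integer
  \<open>c\<close> clears the denominator of \<open>a / b\<close>.\<close>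

lemma denominator:
  assumes x: "x \<in> carrier K"
  obtains m where "m \<noteq> 0" "int_embed m \<otimes> x \<in> R"
proof -
  obtain a b where ab: "a \<in> R" "b \<in> R" "b \<in> Units K" "x = a \<otimes> inv b"
    and nzd: "\<And>r. r \<in> R \<Longrightarrow> b \<otimes> r = \<zero> \<Longrightarrow> r = \<zero>"
    using total_quotientE[OF x] by blast
  obtain c y where cy: "c \<noteq> 0" "y \<in> R" "int_embed c \<otimes> b = b \<otimes> b \<otimes> y"
    using quasi_regular[OF ab(2)] by blast
  have "b \<otimes> (int_embed c \<ominus> b \<otimes> y) = int_embed c \<otimes> b \<ominus> b \<otimes> b \<otimes> y"
    using ab cy(2) by (simp add: minus_eq r_distr r_minus m_ac)
  also have "\<dots> = \<zero>" using ab cy by (simp add: minus_eq r_neg)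
  finally have "int_embed c \<ominus> b \<otimes> y = \<zero>"
    using nzd[of "int_embed c \<ominus> b \<otimes> y"] ab cy(2) by (simp add: minus_eq)
  then have "int_embed c = b \<otimes> y" using ab cy(2) by simp
  moreover have "(b \<otimes> y) \<otimes> (a \<otimes> inv b) = (b \<otimes> inv b) \<otimes> (y \<otimes> a)"
    using ab(1-3) cy(2) by (simp add: m_ac del: Units_r_inv)
  ultimately have "int_embed c \<otimes> x = (b \<otimes> inv b) \<otimes> (y \<otimes> a)"
    using ab(4) by simp
  then have "int_embed c \<otimes> x \<in> R" using ab cy(2) by simp
  then show ?thesis using that cy(1) by blast
qed

lemma denominator_mult:
  assumes "int_embed a \<otimes> x \<in> R" "x \<in> carrier K"
  shows "int_embed (b * a) \<otimes> x \<in> R"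
  using assms R_mult[OF int_embed_R[of b] assms(1)] by (simp add: int_embed_mult m_assoc)

text \<open>If \<open>m x\<close> lies in \<open>R\<close> and \<open>x\<close> satisfies a monic
  equation of degree \<open>N\<close>, then \<open>m ^ N\<close> clears the denominators of all
  powers below \<open>N\<close>, and the equation expresses every higher power by lower
  ones.\<close>

lemma maximal_order_bounded:
  assumes "x \<in> maximal_order K"
  obtains m where "m \<noteq> 0" "\<forall>k :: nat. int_embed m \<otimes> x [^] k \<in> R"
proof -
  obtain p where x: "x \<in> carrier K"
    and p: "Polynomial.coeff p (Polynomial.degree p) = 1" "int_poly_eval p x = \<zero>"
    using assms maximal_order_iff by blast
  let ?N = "Polynomial.degree p"
  obtain m where m: "m \<noteq> 0" "int_embed m \<otimes> x \<in> R" using denominator[OF x] .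
  have pow: "int_embed (m ^ i) \<otimes> x [^] i \<in> R" for i :: nat
  proof (induction i)
    case (Suc i)
    have "int_embed (m ^ Suc i) \<otimes> x [^] Suc i = (int_embed m \<otimes> x) \<otimes> (int_embed (m ^ i) \<otimes> x [^] i)"
      using x by (simp add: int_embed_mult m_ac)
    then show ?case using Suc m by simp
  qed simp
  have "int_embed (m ^ ?N) \<otimes> x [^] k \<in> R" for k :: nat
  proof (induction k rule: less_induct)
    case (less k)
    show ?case
    proof (cases "k < ?N")
      case True
      then have "m ^ ?N = m ^ (?N - k) * m ^ k" by (simp flip: power_add)
      then show ?thesis using denominator_mult[OF pow[of k]] x by simp
    next
      case False
      let ?p = "Polynomial.monom 1 (k - ?N) * p"
      \<comment> \<open>The subtracted multiple of \<open>p\<close> vanishes at \<open>x\<close>, so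
        \<open>?r\<close> still evaluates to \<open>x^k\<close>, while its leading terms
        cancel.\<close>
      let ?r = "Polynomial.monom 1 k - ?p"
      have cp: "Polynomial.coeff ?p i = (if i < k - ?N then 0 else Polynomial.coeff p (i - (k - ?N)))" for i
        by (simp add: coeff_monom_mult)
      have "Polynomial.coeff ?r i = 0" if "i \<ge> k" for i
        using that False p(1) by (auto simp: cp coeff_eq_0)
      then have deg: "i < k" if "i \<le> Polynomial.degree ?r" "k \<noteq> 0" for i
        using that by (metis degree_lessI linorder_not_le order.strict_trans1 gr0I)
      have ev: "int_poly_eval ?r x = x [^] k"
        using x p(2) by (simp add: int_poly_eval_diff int_poly_eval_monom int_poly_eval_monom_mult minus_eq)
      show ?thesis
      \<comment> \<open>For \<open>k = 0\<close> the zero polynomial has degree 0, which is not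
        below \<open>k\<close>. In that case \<open>p = 1\<close>, so \<open>K\<close> is the zero
        ring.\<close>
      proof (cases "k = 0")
        case True
        then have "p = 1" using False p(1) by (metis degree_eq_zeroE coeff_pCons_0 gr0I one_pCons degree_pCons_0)
        then have "\<one> = \<zero>" using p(2) x int_poly_eval_pCons[OF x, of 1 0] by (simp add: one_pCons)
        then have "int_embed (m ^ ?N) \<otimes> x [^] k = \<zero>" using x by (metis True nat_pow_0 r_null int_embed_closed)
        then show ?thesis by simp
      next
        case False
        then show ?thesis using int_poly_eval_R[OF x less.IH[OF deg], of ?r] ev by simp
      qed
    qed
  qed
  then show ?thesis using that[of "m ^ ?N"] m by simp
qed

lemma maximal_order_closed [simp]: "x \<in> maximal_order K \<Longrightarrow> x \<in> carrier K"
  by (simp add: maximal_order_def)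

lemma maximal_order_mult:
  assumes "x \<in> maximal_order K" "y \<in> maximal_order K"
  shows "x \<otimes> y \<in> maximal_order K"
proof -
  obtain a where a: "a \<noteq> 0" "\<forall>k :: nat. int_embed a \<otimes> x [^] k \<in> R"
    using maximal_order_bounded[OF assms(1)] .
  obtain b where b: "b \<noteq> 0" "\<forall>k :: nat. int_embed b \<otimes> y [^] k \<in> R"
    using maximal_order_bounded[OF assms(2)] .
  have "int_embed (a * b) \<otimes> (x \<otimes> y) [^] k = (int_embed a \<otimes> x [^] k) \<otimes> (int_embed b \<otimes> y [^] k)"
    for k :: nat
    using assms by (simp add: int_embed_mult nat_pow_distrib m_ac)
  then show ?thesis using assms a b by (intro maximal_orderI[of _ "a * b"]) auto
qed

lemma maximal_order_add:
  assumes "x \<in> maximal_order K" "y \<in> maximal_order K"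
  shows "x \<oplus> y \<in> maximal_order K"
proof -
  obtain a where a: "a \<noteq> 0" "\<forall>k :: nat. int_embed a \<otimes> x [^] k \<in> R"
    using maximal_order_bounded[OF assms(1)] .
  obtain b where b: "b \<noteq> 0" "\<forall>k :: nat. int_embed b \<otimes> y [^] k \<in> R"
    using maximal_order_bounded[OF assms(2)] .
  have xy: "x \<in> carrier K" "y \<in> carrier K" using assms by auto
  \<comment> \<open>Carrying arbitrary monomials along lets each factor \<open>x \<oplus> y\<close>
    be split off by distributivity, in place of a binomial expansion.\<close>
  have "int_embed (a * b) \<otimes> (x [^] i \<otimes> y [^] j \<otimes> (x \<oplus> y) [^] k) \<in> R" for i j k :: nat
  proof (induction k arbitrary: i j)
    case 0
    have "int_embed (a * b) \<otimes> (x [^] i \<otimes> y [^] j) = (int_embed a \<otimes> x [^] i) \<otimes> (int_embed b \<otimes> y [^] j)"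
      using xy by (simp add: int_embed_mult m_ac)
    then show ?case using a b xy by simp
  next
    case (Suc k)
    let ?t = "\<lambda>i j. int_embed (a * b) \<otimes> (x [^] i \<otimes> y [^] j \<otimes> (x \<oplus> y) [^] k)"
    have "int_embed (a * b) \<otimes> (x [^] i \<otimes> y [^] j \<otimes> (x \<oplus> y) [^] Suc k) = ?t (Suc i) j \<oplus> ?t i (Suc j)"
      using xy by (simp add: l_distr r_distr m_ac)
    then show ?case using Suc.IH[of "Suc i" j] Suc.IH[of i "Suc j"] by (metis R_add)
  qed
  from this[of 0 0] show ?thesis
    using xy a b by (intro maximal_orderI[of _ "a * b"]) auto
qed

lemma maximal_order_minus: "x \<in> maximal_order K \<Longrightarrow> \<ominus> x \<in> maximal_order K"
  using maximal_order_mult[of "\<ominus> \<one>" x] R_subset_maximal_order R_minus[OF R_one]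
  by (auto simp: l_minus subset_iff)

section \<open>The trace form\<close>

text \<open>A denominator \<open>m\<close> of \<open>x\<close> is cleared, the integer coordinates
  are read off through \<open>\<phi>\<close>, and the result is divided by \<open>m\<close>. By
  \<open>coord_eq\<close> every admissible \<open>m\<close> gives the same value.\<close>

definition coord :: "'a \<Rightarrow> nat \<Rightarrow> rat" where
  "coord x i = (let m = SOME m. m \<noteq> 0 \<and> int_embed m \<otimes> x \<in> R
     in of_int (Poly_Mapping.lookup (\<phi> (int_embed m \<otimes> x)) i) / of_int m)"

lemma coord_eq:
  assumes x: "x \<in> carrier K" and m: "m \<noteq> 0" "int_embed m \<otimes> x \<in> R"
  shows "coord x i = of_int (Poly_Mapping.lookup (\<phi> (int_embed m \<otimes> x)) i) / of_int m"
proof -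
  define a where "a = (SOME m. m \<noteq> 0 \<and> int_embed m \<otimes> x \<in> R)"
  have a: "a \<noteq> 0" "int_embed a \<otimes> x \<in> R"
    using someI[of "\<lambda>m. m \<noteq> 0 \<and> int_embed m \<otimes> x \<in> R" m] m by (auto simp: a_def)
  have "int_embed a \<otimes> (int_embed m \<otimes> x) = int_embed m \<otimes> (int_embed a \<otimes> x)"
    using x by (simp add: m_lcomm)
  then have "frag_cmul a (\<phi> (int_embed m \<otimes> x)) = frag_cmul m (\<phi> (int_embed a \<otimes> x))"
    using \<phi>_int[OF m(2), of a] \<phi>_int[OF a(2), of m] by simp
  then have "a * Poly_Mapping.lookup (\<phi> (int_embed m \<otimes> x)) i =
      m * Poly_Mapping.lookup (\<phi> (int_embed a \<otimes> x)) i"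
    by (metis lookup_frag_cmul)
  then have "of_int a * of_int (Poly_Mapping.lookup (\<phi> (int_embed m \<otimes> x)) i) =
      (of_int m * of_int (Poly_Mapping.lookup (\<phi> (int_embed a \<otimes> x)) i) :: rat)"
    by (metis of_int_mult)
  then show ?thesis
    using a(1) m(1) by (simp add: coord_def Let_def a_def[symmetric] field_simps)
qed

lemma coord_R: "r \<in> R \<Longrightarrow> coord r i = of_int (Poly_Mapping.lookup (\<phi> r) i)"
  using coord_eq[of r 1] by simp

lemma coord_add:
  assumes x: "x \<in> carrier K" and y: "y \<in> carrier K"
  shows "coord (x \<oplus> y) i = coord x i + coord y i"
proof -
  obtain a where a: "a \<noteq> 0" "int_embed a \<otimes> x \<in> R" using denominator[OF x] .
  obtain b where b: "b \<noteq> 0" "int_embed b \<otimes> y \<in> R" using denominator[OF y] .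
  have ab: "a * b \<noteq> 0" using a b by simp
  have x': "int_embed (a * b) \<otimes> x \<in> R" using denominator_mult[OF a(2) x, of b] by (simp add: mult.commute)
  have y': "int_embed (a * b) \<otimes> y \<in> R" using denominator_mult[OF b(2) y] .
  have "int_embed (a * b) \<otimes> (x \<oplus> y) = int_embed (a * b) \<otimes> x \<oplus> int_embed (a * b) \<otimes> y"
    using x y by (simp add: r_distr)
  then show ?thesis
    using coord_eq[OF _ ab, of "x \<oplus> y" i] coord_eq[OF x ab x', of i] coord_eq[OF y ab y', of i] x y x' y'
    by (simp add: \<phi>_add lookup_add add_divide_distrib)
qed

lemma coord_int_embed:
  assumes x: "x \<in> carrier K"
  shows "coord (int_embed k \<otimes> x) i = of_int k * coord x i"
proof -
  obtain a where a: "a \<noteq> 0" "int_embed a \<otimes> x \<in> R" using denominator[OF x] .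
  have eq: "int_embed a \<otimes> (int_embed k \<otimes> x) = int_embed k \<otimes> (int_embed a \<otimes> x)"
    using x by (simp add: m_lcomm)
  show ?thesis
    using coord_eq[OF x a, of i] coord_eq[of "int_embed k \<otimes> x" a i] x a \<phi>_int[OF a(2), of k]
    by (simp add: eq)
qed

lemma R_eq_zeroI: "r \<in> R \<Longrightarrow> (\<And>i. i < n \<Longrightarrow> coord r i = 0) \<Longrightarrow> r = \<zero>"
proof -
  assume r: "r \<in> R" and 0: "\<And>i. i < n \<Longrightarrow> coord r i = 0"
  have "Poly_Mapping.lookup (\<phi> r) i = 0" for i
    using 0[of i] r keys_\<phi>[OF r] by (cases "i < n") (auto simp: coord_R in_keys_iff)
  then have "\<phi> r = \<phi> \<zero>" by (intro poly_mapping_eqI) (simp add: \<phi>_zero)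
  then show "r = \<zero>" by (rule inj_onD[OF \<phi>_inj]) (use r in auto)
qed

lemma R_of_coords:
  fixes v :: "nat \<Rightarrow> int"
  obtains r where "r \<in> R" "\<forall>i<n. coord r i = of_int (v i)"
proof -
  let ?c = "\<Sum>j<n. frag_cmul (v j) (frag_of j)"
  have lookup: "Poly_Mapping.lookup ?c i = (if i < n then v i else 0)" for i
  proof -
    have "Poly_Mapping.lookup ?c i = (\<Sum>j<n. if j = i then v i else 0)"
      unfolding lookup_sum by (intro sum.cong) auto
    then show ?thesis by simp
  qed
  then have "Poly_Mapping.keys ?c \<subseteq> {..<n}" by (auto simp: in_keys_iff split: if_splits)
  then obtain r where "r \<in> R" "\<phi> r = ?c" using \<phi>_image by (metis (mono_tags, lifting) imageE mem_Collect_eq)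
  then show ?thesis using that[of r] lookup by (simp add: coord_R)
qed

lemma R_if_coord_Ints:
  assumes x: "x \<in> carrier K" and int: "\<And>i. i < n \<Longrightarrow> coord x i \<in> \<int>"
  shows "x \<in> R"
proof -
  obtain r where r: "r \<in> R" "\<forall>i<n. coord r i = of_int \<lfloor>coord x i\<rfloor>"
    using R_of_coords[of "\<lambda>i. \<lfloor>coord x i\<rfloor>"] .
  obtain m where m: "m \<noteq> 0" "int_embed m \<otimes> x \<in> R" using denominator[OF x] .
  \<comment> \<open>Scaling the difference of \<open>x\<close> and \<open>r\<close> by
    \<open>m\<close> brings it into \<open>R\<close>, where vanishing coordinates force
    zero.\<close>
  let ?d = "int_embed m \<otimes> x \<oplus> int_embed (- m) \<otimes> r"
  have "coord ?d i = 0" if i: "i < n" for i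
  proof -
    have "coord r i = coord x i" using r(2) i int[OF i] by (simp add: of_int_floor_cancel)
    then show ?thesis using x r(1) by (simp add: coord_add coord_int_embed)
  qed
  then have "?d = \<zero>" using m r(1) by (intro R_eq_zeroI) auto
  then have "int_embed m \<otimes> x = int_embed m \<otimes> r"
    using x r(1) by (simp add: int_embed_minus l_minus minus_eq[symmetric])
  then have "x = r" using torsion_free_cancel x r(1) m(1) by simp
  then show ?thesis using r by simp
qed

definition basis :: "nat \<Rightarrow> 'a" where
  "basis i = inv_into R \<phi> (frag_of i)"

lemma basis:
  assumes "i < n"
  shows "basis i \<in> R" "\<phi> (basis i) = frag_of i"
proof -
  have "frag_of i \<in> \<phi> ` R" using assms by (simp add: \<phi>_image)
  then show "basis i \<in> R" "\<phi> (basis i) = frag_of i"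
    unfolding basis_def by (auto intro: inv_into_into f_inv_into_f)
qed

lemma basis_closed [simp]: "i < n \<Longrightarrow> basis i \<in> carrier K"
  using basis(1) by simp

text \<open>An additive map into the rationals is automatically rational-linear. The formula is
  proved on \<open>R\<close> by induction over coordinate vectors and extended to \<open>K\<close>
  by dividing by a denominator.\<close>

lemma additive_expand:
  fixes f :: "'a \<Rightarrow> rat"
  assumes add: "\<And>x y. x \<in> carrier K \<Longrightarrow> y \<in> carrier K \<Longrightarrow> f (x \<oplus> y) = f x + f y"
    and x: "x \<in> carrier K"
  shows "f x = (\<Sum>i<n. coord x i * f (basis i))"
proof -
  have zero: "f \<zero> = 0" using add[of \<zero> \<zero>] by simp
  have minus: "f (\<ominus> y) = - f y" if "y \<in> carrier K" for y
    using add[of y "\<ominus> y"] that zero by (simp add: r_neg eq_neg_iff_add_eq_0 add.commute)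
  have int: "f (int_embed k \<otimes> y) = of_int k * f y" if y: "y \<in> carrier K" for k y
  proof (induction k rule: int_induct[where k = 0])
    case base
    then show ?case using y zero by simp
  next
    case (step1 i)
    then show ?case using y by (simp add: int_embed_add l_distr add distrib_right)
  next
    case (step2 i)
    then show ?case using y int_embed_add[of i "- 1"] int_embed_minus[of 1]
      by (simp add: l_distr l_minus add minus left_diff_distrib)
  qed
  let ?g = "\<lambda>c. \<Sum>i<n. of_int (Poly_Mapping.lookup c i) * f (basis i)"
  have "\<exists>r \<in> R. \<phi> r = c \<and> f r = ?g c" if "Poly_Mapping.keys c \<subseteq> {..<n}" for c
    using that
  proof (induction rule: frag_induction)
    case zero
    show ?case by (rule bexI[of _ \<zero>]) (auto simp: \<phi>_zero \<open>f \<zero> = 0\<close>)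
  next
    case (one j)
    have "?g (frag_of j) = (\<Sum>i<n. if i = j then f (basis j) else 0)"
      by (intro sum.cong) auto
    then show ?case using one basis[of j] by (intro bexI[of _ "basis j"]) auto
  next
    case (diff a b)
    then obtain r s where rs: "r \<in> R" "\<phi> r = a" "f r = ?g a" "s \<in> R" "\<phi> s = b" "f s = ?g b" by blast
    show ?case
    proof (intro bexI conjI)
      show "r \<oplus> \<ominus> s \<in> R" using rs by simp
      show "\<phi> (r \<oplus> \<ominus> s) = a - b" using rs by (simp add: \<phi>_add \<phi>_minus)
      show "f (r \<oplus> \<ominus> s) = ?g (a - b)"
        using rs by (simp add: add minus lookup_minus left_diff_distrib sum_subtractf)
    qed
  qed
  then have R: "f r = ?g (\<phi> r)" if "r \<in> R" for r
    using inj_onD[OF \<phi>_inj, of _ r] keys_\<phi>[OF that] that by metis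
  obtain m where m: "m \<noteq> 0" "int_embed m \<otimes> x \<in> R" using denominator[OF x] .
  have "of_int m * f x = ?g (\<phi> (int_embed m \<otimes> x))" using int[OF x] R[OF m(2)] by simp
  also have "\<dots> = (\<Sum>i<n. of_int m * (coord x i * f (basis i)))"
    using m(1) by (intro sum.cong) (auto simp: coord_eq[OF x m])
  finally show ?thesis using m(1) by (simp flip: sum_distrib_left)
qed

section \<open>Multiplication matrices and their traces\<close>

definition mult_mat :: "'a \<Rightarrow> rat mat" where
  "mult_mat x = mat n n (\<lambda>(i, j). coord (x \<otimes> basis j) i)"

definition trace :: "'a \<Rightarrow> rat" where
  "trace x = (\<Sum>i<n. coord (x \<otimes> basis i) i)"

lemma mult_mat_carrier [simp]: "mult_mat x \<in> carrier_mat n n"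
  by (simp add: mult_mat_def)

lemma mult_mat_index [simp]: "i < n \<Longrightarrow> j < n \<Longrightarrow> mult_mat x $$ (i, j) = coord (x \<otimes> basis j) i"
  by (simp add: mult_mat_def)

lemma trace_mult_mat: "trace x = (\<Sum>i<n. mult_mat x $$ (i, i))"
  by (simp add: trace_def)

lemma trace_add: "x \<in> carrier K \<Longrightarrow> y \<in> carrier K \<Longrightarrow> trace (x \<oplus> y) = trace x + trace y"
  by (simp add: trace_def l_distr coord_add sum.distrib)

lemma coord_mult_expand:
  assumes "x \<in> carrier K" "y \<in> carrier K"
  shows "coord (x \<otimes> y) i = (\<Sum>j<n. coord y j * coord (x \<otimes> basis j) i)"
  using assms by (intro additive_expand[of "\<lambda>y. coord (x \<otimes> y) i"]) (auto simp: r_distr coord_add)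

lemma trace_mult_expand:
  assumes "x \<in> carrier K" "y \<in> carrier K"
  shows "trace (x \<otimes> y) = (\<Sum>j<n. coord y j * trace (x \<otimes> basis j))"
  using assms by (intro additive_expand[of "\<lambda>y. trace (x \<otimes> y)"]) (auto simp: r_distr trace_add)

lemma mult_mat_mult:
  assumes x: "x \<in> carrier K" and y: "y \<in> carrier K"
  shows "mult_mat (x \<otimes> y) = mult_mat x * mult_mat y"
proof (rule eq_matI)
  fix i j assume "i < dim_row (mult_mat x * mult_mat y)" "j < dim_col (mult_mat x * mult_mat y)"
  then have ij: "i < n" "j < n" by (auto simp: mult_mat_def)
  have "mult_mat (x \<otimes> y) $$ (i, j) = coord (x \<otimes> (y \<otimes> basis j)) i"
    using ij x y by (simp add: m_assoc)
  also have "\<dots> = (\<Sum>k<n. coord (y \<otimes> basis j) k * coord (x \<otimes> basis k) i)"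
    using ij x y by (intro coord_mult_expand) auto
  finally show "mult_mat (x \<otimes> y) $$ (i, j) = (mult_mat x * mult_mat y) $$ (i, j)"
    using ij by (simp add: index_mult_mat_sum[OF mult_mat_carrier mult_mat_carrier ij] mult.commute)
qed (auto simp: mult_mat_def)

lemma mult_mat_one: "mult_mat \<one> = 1\<^sub>m n"
  by (rule eq_matI) (auto simp: mult_mat_def coord_R basis)

lemma mult_mat_pow:
  assumes "x \<in> carrier K"
  shows "mult_mat (x [^] (k :: nat)) = mult_mat x ^\<^sub>m k"
  using assms by (induction k) (auto simp: mult_mat_one mult_mat_mult carrier_matD[OF mult_mat_carrier])

text \<open>An \<open>m\<close> with all \<open>m x^k\<close> in \<open>R\<close> also makes all
  entries of \<open>m\<close> times the powers of the multiplication matrix integral, since column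
  \<open>j\<close> holds the coordinates of \<open>m x^k\<close> times the basis element
  \<open>j\<close>.\<close>

lemma trace_Ints:
  assumes x: "x \<in> maximal_order K"
  shows "trace x \<in> \<int>"
proof -
  have xK: "x \<in> carrier K" using x by simp
  obtain m where m: "m \<noteq> 0" "\<forall>k :: nat. int_embed m \<otimes> x [^] k \<in> R"
    using maximal_order_bounded[OF x] .
  show ?thesis
    unfolding trace_mult_mat
  proof (rule trace_Ints_if_powers_bounded_denominator[OF mult_mat_carrier m(1)])
    fix k i j assume ij: "i < n" "j < n"
    have "of_int m * (mult_mat x ^\<^sub>m k) $$ (i, j) = coord (int_embed m \<otimes> (x [^] k \<otimes> basis j)) i"
      using ij xK by (simp add: coord_int_embed flip: mult_mat_pow)
    also have "int_embed m \<otimes> (x [^] k \<otimes> basis j) = (int_embed m \<otimes> x [^] k) \<otimes> basis j"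
      using ij xK by (simp add: m_assoc)
    also have "coord \<dots> i \<in> \<int>" using m(2) ij basis(1) by (simp add: coord_R)
    finally show "of_int m * (mult_mat x ^\<^sub>m k) $$ (i, j) \<in> \<int>" .
  qed
qed

text \<open>The element \<open>z y\<close> satisfies \<open>e e = c e\<close>, and its trace is a
  combination of the vanishing traces. A scaled idempotent matrix of trace 0 is zero, so
  \<open>e = 0\<close> and hence \<open>c z = z e = 0\<close>.\<close>

lemma trace_nondegenerate:
  assumes z: "z \<in> R" and tr: "\<And>i. i < n \<Longrightarrow> trace (z \<otimes> basis i) = 0"
  shows "z = \<zero>"
proof -
  obtain c y where cy: "c \<noteq> 0" "y \<in> R" "int_embed c \<otimes> z = z \<otimes> z \<otimes> y"
    using quasi_regular[OF z] .
  let ?e = "z \<otimes> y"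
  have e: "?e \<in> R" using z cy by simp
  have "?e \<otimes> ?e = (z \<otimes> z \<otimes> y) \<otimes> y" using z cy(2) by (simp add: m_ac)
  also have "\<dots> = int_embed c \<otimes> ?e" using z cy(2) by (simp add: m_assoc flip: cy(3))
  finally have idem: "?e \<otimes> ?e = int_embed c \<otimes> ?e" .
  have "mult_mat (int_embed c \<otimes> ?e) = of_int c \<cdot>\<^sub>m mult_mat ?e"
    using e by (intro eq_matI) (auto simp: mult_mat_def coord_int_embed m_assoc)
  then have "mult_mat ?e * mult_mat ?e = of_int c \<cdot>\<^sub>m mult_mat ?e"
    using mult_mat_mult[of ?e ?e] e idem by simp
  moreover have "(\<Sum>i<n. mult_mat ?e $$ (i, i)) = 0"
    using trace_mult_expand[of z y] z cy(2) tr unfolding trace_mult_mat[symmetric] by simp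
  ultimately have M: "mult_mat ?e = 0\<^sub>m n n"
    using cy(1) by (intro scaled_idempotent_trace_0[of _ n "of_int c"]) auto
  have "coord (?e \<otimes> basis j) i = 0" if "i < n" "j < n" for i j
    using arg_cong[OF M, of "\<lambda>A. A $$ (i, j)"] that by simp
  then have "coord ?e i = 0" if "i < n" for i
    using coord_mult_expand[of ?e \<one> i] e that by simp
  then have "?e = \<zero>" using e by (intro R_eq_zeroI)
  then have "int_embed c \<otimes> z = \<zero>" using z cy(2,3) by (simp add: m_assoc)
  then show ?thesis using torsion_free z cy(1) by simp
qed

text \<open>For integral \<open>x\<close> the traces of \<open>x\<close> times the basis elements
  are integers, and they are the Gram matrix of the trace form applied to the coordinates of
  \<open>x\<close>. Nondegeneracy then bounds all coordinates by one denominator.\<close>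

lemma maximal_order_common_denominator:
  obtains d where "d \<noteq> 0" "\<forall>x \<in> maximal_order K. int_embed d \<otimes> x \<in> R"
proof -
  \<comment> \<open>The floor only casts the trace to an integer; for \<open>i, j < n\<close> the
    trace is already integral.\<close>
  define G where "G i j = \<lfloor>trace (basis i \<otimes> basis j)\<rfloor>" for i j
  have G: "of_int (G i j) = trace (basis i \<otimes> basis j)" if "i < n" "j < n" for i j
  proof -
    have "basis i \<otimes> basis j \<in> maximal_order K"
      using that basis(1) R_subset_maximal_order by auto
    then show ?thesis using trace_Ints by (simp add: G_def of_int_floor_cancel)
  qed
  have trG: "(\<Sum>j<n. of_int (G i j) * coord x j) = trace (basis i \<otimes> x)" if "i < n" "x \<in> carrier K" for i x
    using that by (subst trace_mult_expand) (auto simp: G mult.commute intro!: sum.cong)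
  have "\<forall>j<n. v j = 0" if v: "\<forall>i<n. (\<Sum>j<n. G i j * v j) = 0" for v :: "nat \<Rightarrow> int"
  proof -
    obtain z where z: "z \<in> R" "\<forall>i<n. coord z i = of_int (v i)"
      using R_of_coords[of v] .
    have "trace (z \<otimes> basis i) = 0" if i: "i < n" for i
    proof -
      have "trace (z \<otimes> basis i) = (\<Sum>j<n. of_int (G i j) * coord z j)"
        using trG[OF i, of z] z(1) i by (simp add: m_comm)
      also have "\<dots> = of_int (\<Sum>j<n. G i j * v j)" using z(2) by simp
      finally show ?thesis using v i by simp
    qed
    then have "z = \<zero>" by (rule trace_nondegenerate[OF z(1)])
    then show ?thesis using z(2) by (simp add: coord_R \<phi>_zero)
  qed
  then have "\<exists>d \<noteq> 0. \<forall>c :: nat \<Rightarrow> rat. (\<forall>i<n. (\<Sum>j<n. of_int (G i j) * c j) \<in> \<int>) \<longrightarrow>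
      (\<forall>j<n. of_int d * c j \<in> \<int>)"
    by (rule nondegenerate_imp_bounded_denominator)
  then obtain d where d: "d \<noteq> 0"
    and int: "\<forall>c :: nat \<Rightarrow> rat. (\<forall>i<n. (\<Sum>j<n. of_int (G i j) * c j) \<in> \<int>) \<longrightarrow>
      (\<forall>j<n. of_int d * c j \<in> \<int>)"
    by (elim exE conjE)
  have "int_embed d \<otimes> x \<in> R" if x: "x \<in> maximal_order K" for x
  proof (rule R_if_coord_Ints)
    fix j assume j: "j < n"
    have "basis i \<otimes> x \<in> maximal_order K" if "i < n" for i
      using x basis(1)[OF that] R_subset_maximal_order by (intro maximal_order_mult) auto
    then have "\<forall>i<n. (\<Sum>j<n. of_int (G i j) * coord x j) \<in> \<int>"
      using trG x trace_Ints by simp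
    with spec[OF int, of "coord x"] have "\<forall>j<n. of_int d * coord x j \<in> \<int>" by (rule mp)
    then have "of_int d * coord x j \<in> \<int>" using j by simp
    then show "coord (int_embed d \<otimes> x) j \<in> \<int>" using x by (simp add: coord_int_embed)
  qed (use x in simp)
  then show ?thesis using that[OF d] by simp
qed

section \<open>Over-orders\<close>

text \<open>Closure under negation comes from multiplication by the element
  \<open>\<ominus> \<one>\<close> of \<open>R\<close>.\<close>

lemma sub_R_module_iff:
  "sub_R_module K R I \<longleftrightarrow> I \<subseteq> carrier K \<and> \<zero> \<in> I \<and>
    (\<forall>x \<in> I. \<forall>y \<in> I. x \<oplus> y \<in> I) \<and> (\<forall>a \<in> R. \<forall>x \<in> I. a \<otimes> x \<in> I)"
    (is "_ \<longleftrightarrow> ?P I")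
proof
  assume "sub_R_module K R I"
  then interpret Module.submodule I "K\<lparr>carrier := R\<rparr>" "self_module K" by (simp add: sub_R_module_def)
  show "?P I"
    using subset m_closed one_closed smult_closed by (auto simp: self_module_def)
next
  assume I: "?P I"
  have minus: "\<ominus> x \<in> I" if "x \<in> I" for x
  proof -
    have "x \<in> carrier K" using I that by blast
    then have "\<ominus> x = \<ominus> \<one> \<otimes> x" by (simp add: l_minus)
    moreover have "\<ominus> \<one> \<otimes> x \<in> I" using I that by simp
    ultimately show ?thesis by metis
  qed
  have inv: "inv\<^bsub>add_monoid (self_module K)\<^esub> x = \<ominus> x" for x
    by (simp add: a_inv_def m_inv_def self_module_def)
  have "subgroup I (add_monoid (self_module K))"
    by (rule subgroup.intro) (use I minus in \<open>simp_all add: inv, simp_all add: self_module_def\<close>)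
  then show "sub_R_module K R I"
    using I by (simp add: sub_R_module_def Module.submodule_def Module.submodule_axioms_def self_module_def)
qed

lemma generated_module_superset: "B \<subseteq> generated_module K R B"
  by (auto simp: generated_module_def)

lemma generated_module_least: "sub_R_module K R I \<Longrightarrow> B \<subseteq> I \<Longrightarrow> generated_module K R B \<subseteq> I"
  by (auto simp: generated_module_def)

lemma sub_R_module_carrier: "sub_R_module K R (carrier K)"
  by (auto simp: sub_R_module_iff)

lemma sub_R_module_generated:
  assumes "B \<subseteq> carrier K"
  shows "sub_R_module K R (generated_module K R B)"
proof -
  have "generated_module K R B \<subseteq> carrier K"
    using assms sub_R_module_carrier by (rule generated_module_least[rotated])
  then show ?thesis
    unfolding sub_R_module_iff by (auto simp: generated_module_def sub_R_module_iff)
qed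

lemma generated_module_eq: "sub_R_module K R I \<Longrightarrow> generated_module K R I = I"
  using generated_module_superset generated_module_least by (intro antisym) auto

lemma sub_R_module_maximal_order: "sub_R_module K R (maximal_order K)"
  unfolding sub_R_module_iff
proof (intro conjI ballI subsetI)
  fix a x assume "a \<in> R" "x \<in> maximal_order K"
  then show "a \<otimes> x \<in> maximal_order K"
    using R_subset_maximal_order by (blast intro: maximal_order_mult)
qed (use R_subset_maximal_order R_zero maximal_order_add in auto)

lemma sub_R_module_minus:
  assumes "sub_R_module K R I" "x \<in> I"
  shows "\<ominus> x \<in> I"
proof -
  have "x \<in> carrier K" "\<ominus> \<one> \<otimes> x \<in> I" using assms by (auto simp: sub_R_module_iff)
  then show ?thesis by (simp add: l_minus)
qed

section \<open>The quotient of the maximal order by \<open>R\<close>\<close>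

lemma subring_maximal_order: "subring (maximal_order K) K"
  by (rule subringI)
    (use R_subset_maximal_order R_one in
      \<open>auto simp: maximal_order_add maximal_order_mult maximal_order_minus\<close>)

abbreviation KO :: "('a, 'm) ring_scheme" where
  "KO \<equiv> K\<lparr>carrier := maximal_order K\<rparr>"

lemma abelian_subgroup_R: "abelian_subgroup R KO"
proof -
  interpret O: ring KO by (rule subring_is_ring[OF subring_maximal_order])
  have "subgroup R (add_monoid K)" using R_subring by (simp add: subring_def)
  moreover have "subgroup (maximal_order K) (add_monoid K)"
    using subring_maximal_order by (simp add: subring_def)
  ultimately have "subgroup R (add_monoid K\<lparr>carrier := maximal_order K\<rparr>)"
    using R_subset_maximal_order by (rule add.subgroup_incl)
  then have "subgroup R (add_monoid KO)" by simp
  then have "additive_subgroup R KO" by (rule additive_subgroup.intro)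
  then show ?thesis by (rule abelian_subgroupI3[OF _ O.abelian_group_axioms])
qed

lemma group_order_quotient: "group (order_quotient K R)"
  unfolding order_quotient_def by (rule abelian_subgroup.a_factorgroup_is_group[OF abelian_subgroup_R])

lemma carrier_order_quotient: "carrier (order_quotient K R) = quotient_map K R ` maximal_order K"
  by (auto simp: order_quotient_def quotient_map_def A_FactGroup_def carrier_FactGroup a_r_coset_def)

lemma one_order_quotient: "\<one>\<^bsub>order_quotient K R\<^esub> = R"
  by (simp add: order_quotient_def A_FactGroup_def)

lemma quotient_map_hom: "quotient_map K R \<in> hom (add_monoid KO) (order_quotient K R)"
  using abelian_subgroup.a_r_coset_hom_A_Mod[OF abelian_subgroup_R]
  by (simp add: order_quotient_def quotient_map_def[abs_def])

lemma quotient_map_alt: "quotient_map K R x = {r \<oplus> x | r. r \<in> R}"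
  by (auto simp: quotient_map_def a_r_coset_def')

lemma quotient_map_eq_iff:
  assumes x: "x \<in> carrier K" and y: "y \<in> carrier K"
  shows "quotient_map K R x = quotient_map K R y \<longleftrightarrow> x \<ominus> y \<in> R"
proof
  assume eq: "quotient_map K R x = quotient_map K R y"
  have "\<zero> \<oplus> x \<in> quotient_map K R x" unfolding quotient_map_alt using R_zero by blast
  then obtain r where "r \<in> R" "x = r \<oplus> y" using eq x by (auto simp: quotient_map_alt)
  then show "x \<ominus> y \<in> R" using y by (simp add: minus_eq a_assoc r_neg)
next
  assume d: "x \<ominus> y \<in> R"
  have "\<ominus> (x \<ominus> y) = y \<ominus> x" using x y by (simp add: minus_eq minus_add a_comm)
  then have "r \<oplus> x = (r \<oplus> (x \<ominus> y)) \<oplus> y" "r \<oplus> y = (r \<oplus> \<ominus> (x \<ominus> y)) \<oplus> x" if "r \<in> R" for r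
    using x y that by (simp_all add: minus_eq a_assoc l_neg)
  moreover have "r \<oplus> (x \<ominus> y) \<in> R" "r \<oplus> \<ominus> (x \<ominus> y) \<in> R" if "r \<in> R" for r
    using d that by auto
  ultimately show "quotient_map K R x = quotient_map K R y"
    unfolding quotient_map_alt by blast
qed

lemma quotient_map_R: "r \<in> R \<Longrightarrow> quotient_map K R r = R"
proof -
  assume r: "r \<in> R"
  have "quotient_map K R r = quotient_map K R \<zero>"
    using r by (subst quotient_map_eq_iff) (auto simp: minus_eq)
  also have "\<dots> = R" by (force simp: quotient_map_alt)
  finally show ?thesis .
qed

text \<open>With a common denominator \<open>d\<close>, the coset of \<open>x\<close> is determined
  by the integer coordinates of \<open>d x\<close> modulo \<open>d\<close>, and there are only
  finitely many such residue vectors.\<close>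

lemma finite_order_quotient: "finite (carrier (order_quotient K R))"
  unfolding carrier_order_quotient
proof -
  obtain d where d: "d \<noteq> 0" "\<forall>x \<in> maximal_order K. int_embed d \<otimes> x \<in> R"
    using maximal_order_common_denominator .
  define c where "c x i = Poly_Mapping.lookup (\<phi> (int_embed d \<otimes> x)) i" for x i
  define f where "f x = (\<lambda>i \<in> {..<n}. c x i mod d)" for x
  show "finite (quotient_map K R ` maximal_order K)"
  proof (rule finite_image_if_determined)
    \<comment> \<open>The symmetric bound accommodates either sign of \<open>d\<close>, as residues
      take the sign of the divisor.\<close>
    have "\<bar>a mod d\<bar> \<le> \<bar>d\<bar>" for a using abs_mod_less[OF d(1), of a] by simp
    then have "f x \<in> {..<n} \<rightarrow>\<^sub>E {- \<bar>d\<bar>..\<bar>d\<bar>}" for x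
      unfolding f_def by (auto simp: abs_le_iff minus_le_iff)
    then have "f ` maximal_order K \<subseteq> {..<n} \<rightarrow>\<^sub>E {- \<bar>d\<bar>..\<bar>d\<bar>}" by blast
    then show "finite (f ` maximal_order K)"
      by (rule finite_subset) (auto intro: finite_PiE)
    fix x y assume xy: "x \<in> maximal_order K" "y \<in> maximal_order K" "f x = f y"
    have "x \<ominus> y \<in> R"
    proof (rule R_if_coord_Ints)
      fix i assume i: "i < n"
      have "c x i mod d = c y i mod d" using fun_cong[OF xy(3), of i] i by (simp add: f_def)
      then have "d dvd c x i - c y i" by (simp add: mod_eq_dvd_iff)
      then obtain k where k: "c x i - c y i = d * k" by blast
      have cx: "of_int d * coord z i = of_int (c z i)" if "z \<in> maximal_order K" for z
        using coord_int_embed[of z d i] coord_R[of "int_embed d \<otimes> z" i] d(2) that by (simp add: c_def)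
      have "coord (x \<ominus> y) i = coord x i - coord y i"
        using xy coord_add[of x "\<ominus> y" i] coord_int_embed[of y "-1" i] int_embed_minus[of 1]
        by (simp add: minus_eq l_minus)
      then have "of_int d * coord (x \<ominus> y) i = of_int (c x i - c y i)"
        using cx xy by (simp add: right_diff_distrib)
      then have "of_int d * coord (x \<ominus> y) i = of_int d * of_int k" by (simp add: k)
      then have "coord (x \<ominus> y) i = of_int k" using d(1) by simp
      then show "coord (x \<ominus> y) i \<in> \<int>" by simp
    qed (use xy in \<open>simp add: minus_eq\<close>)
    then show "quotient_map K R x = quotient_map K R y"
      using xy by (simp add: quotient_map_eq_iff)
  qed
qed

lemma finite_subgroups_order_quotient: "finite {H. subgroup H (order_quotient K R)}"
proof (rule finite_subset)
  show "{H. subgroup H (order_quotient K R)} \<subseteq> Pow (carrier (order_quotient K R))"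
    using subgroup.subset by blast
qed (use finite_order_quotient in simp)

text \<open>Every element has a nonzero multiple in \<open>R\<close>; a change of sign turns the
  integer factor into the positive natural number asked for by \<open>rational_span\<close>.\<close>

lemma rational_span_eq_carrier:
  assumes "R \<subseteq> I" "I \<subseteq> carrier K"
  shows "rational_span K I = carrier K"
proof -
  have "x \<in> rational_span K I" if x: "x \<in> carrier K" for x
  proof -
    obtain m where m: "m \<noteq> 0" "int_embed m \<otimes> x \<in> R" using denominator[OF x] .
    define k where "k = nat (abs m)"
    have "int_embed (- m) \<otimes> x \<in> R"
      using R_minus[OF m(2)] x by (simp add: int_embed_minus l_minus)
    then have "int_embed (int k) \<otimes> x \<in> R" using m(2) by (simp add: k_def abs_if)
    then have "add_pow K k x \<in> I" using assms(1) unfolding nat_smult_eq[OF x] by blast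
    moreover have "k > 0" using m(1) by (simp add: k_def)
    ultimately show ?thesis using x unfolding rational_span_def by blast
  qed
  then show ?thesis by (auto simp: rational_span_def)
qed

section \<open>Over-orders as idempotent modules\<close>

text \<open>Finitely many generators have a common denominator \<open>m\<close>, which then works
  for all of \<open>S\<close>. As the ring \<open>S\<close> contains all powers of its elements,
  their denominators are bounded and they are integral.\<close>

lemma over_order_imp:
  assumes "over_order K R S"
  shows "sub_R_module K R S" "subring S K" "R \<subseteq> S" "S \<subseteq> maximal_order K"
proof -
  obtain B where S: "sub_R_module K R S" "subring S K"
    and B: "finite B" "B \<subseteq> carrier K" "S = generated_module K R B"
    using assms by (auto simp: over_order_def fractional_ideal_def)
  have "r \<in> S" if "r \<in> R" for r
  proof -
    have "r \<otimes> \<one> \<in> S" using that S subringE(3)[OF S(2)] unfolding sub_R_module_iff by blast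
    then show ?thesis using that by simp
  qed
  then show "sub_R_module K R S" "subring S K" "R \<subseteq> S" using S by auto
  have "\<exists>m. m \<noteq> 0 \<and> (\<forall>b \<in> B. int_embed m \<otimes> b \<in> R)"
    using B(1,2)
  proof (induction B rule: finite_induct)
    case empty
    show ?case by (rule exI[of _ 1]) simp
  next
    case (insert b B)
    then obtain m where m: "m \<noteq> 0" "\<forall>b \<in> B. int_embed m \<otimes> b \<in> R" by auto
    obtain k where k: "k \<noteq> 0" "int_embed k \<otimes> b \<in> R" using denominator[of b] insert.prems by auto
    have "int_embed (m * k) \<otimes> b \<in> R" using denominator_mult[OF k(2)] insert.prems by simp
    moreover have "int_embed (m * k) \<otimes> b' \<in> R" if "b' \<in> B" for b'
      using denominator_mult[of m b' k] m(2) that insert.prems by (auto simp: mult.commute)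
    ultimately show ?case using m(1) k(1) by (intro exI[of _ "m * k"]) auto
  qed
  then obtain m where m: "m \<noteq> 0" "\<forall>b \<in> B. int_embed m \<otimes> b \<in> R" by blast
  let ?J = "{x \<in> carrier K. int_embed m \<otimes> x \<in> R}"
  have "int_embed m \<otimes> (a \<otimes> x) \<in> R" if "a \<in> R" "x \<in> ?J" for a x
    using R_mult[of a "int_embed m \<otimes> x"] that by (simp add: m_lcomm)
  then have "sub_R_module K R ?J"
    by (auto simp: sub_R_module_iff r_distr)
  then have SJ: "S \<subseteq> ?J" unfolding B(3) using B(2) m(2) by (intro generated_module_least) auto
  show "S \<subseteq> maximal_order K"
  proof
    fix x assume x: "x \<in> S"
    have "x [^] k \<in> S" for k :: nat
      using x subringE(3,6)[OF S(2)] by (induction k) auto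
    then show "x \<in> maximal_order K" using SJ x m(1) by (intro maximal_orderI[of x m]) auto
  qed
qed

text \<open>The equation \<open>S S = S\<close> gives closure under products. For finite generation,
  \<open>\<one>\<close> generates \<open>R\<close>, and representatives of the finitely many cosets
  of \<open>R\<close> in \<open>S\<close> generate the rest.\<close>

lemma over_order_if_idempotent:
  assumes S: "sub_R_module K R S" "R \<subseteq> S" "S \<subseteq> maximal_order K" and idem: "ideal_mult K S S = S"
  shows "over_order K R S"
proof -
  have SK: "S \<subseteq> carrier K" using S(3) by auto
  have "x \<otimes> y \<in> S" if "x \<in> S" "y \<in> S" for x y
  proof -
    have "x \<otimes> y \<in> S <#> S" using that by (auto simp: set_mult_def)
    then have "x \<otimes> y \<in> ideal_mult K S S" unfolding ideal_mult_def by (rule generate.incl)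
    then show ?thesis using idem by simp
  qed
  then have subring: "subring S K"
    using S SK sub_R_module_minus[OF S(1)] by (intro subringI) (auto simp: sub_R_module_iff)
  have "finite (quotient_map K R ` S)"
    using finite_order_quotient S(3) unfolding carrier_order_quotient by (meson finite_subset image_mono)
  then obtain C where C: "C \<subseteq> S" "finite C" "quotient_map K R ` S = quotient_map K R ` C"
    by (metis finite_subset_image order_refl)
  let ?B = "insert \<one> C"
  have B: "?B \<subseteq> S" using C S(2) by auto
  have G: "sub_R_module K R (generated_module K R ?B)"
    using B SK by (intro sub_R_module_generated) auto
  have "S = generated_module K R ?B"
  proof
    show "generated_module K R ?B \<subseteq> S" using S(1) B by (rule generated_module_least)
    show "S \<subseteq> generated_module K R ?B"
    proof
      fix s assume s: "s \<in> S"
      then obtain c where c: "c \<in> C" "quotient_map K R s = quotient_map K R c" using C(3) by blast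
      then have d: "s \<ominus> c \<in> R" using s C(1) SK by (subst quotient_map_eq_iff[symmetric]) auto
      have mem: "\<one> \<in> generated_module K R ?B" "c \<in> generated_module K R ?B"
        using c generated_module_superset by blast+
      have "(s \<ominus> c) \<otimes> \<one> \<oplus> c \<in> generated_module K R ?B"
        using G d mem unfolding sub_R_module_iff by blast
      moreover have "s \<in> carrier K" "c \<in> carrier K" using s c C(1) SK by auto
      then have "(s \<ominus> c) \<otimes> \<one> \<oplus> c = s" by (simp add: minus_eq a_assoc l_neg)
      ultimately show "s \<in> generated_module K R ?B" by simp
    qed
  qed
  then have "\<exists>B. finite B \<and> B \<subseteq> carrier K \<and> S = generated_module K R B"
    using C(2) B SK by (intro exI[of _ ?B]) auto
  then show ?thesis
    using S SK subring rational_span_eq_carrier by (simp add: over_order_def fractional_ideal_def)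
qed

lemma ideal_mult_subring:
  assumes S: "subring S K"
  shows "ideal_mult K S S = S"
proof
  have "S <#> S \<subseteq> S" using subringE(6)[OF S] by (auto simp: set_mult_def)
  moreover have "subgroup S (add_monoid K)" using S by (simp add: subring_def)
  ultimately show "ideal_mult K S S \<subseteq> S"
    unfolding ideal_mult_def by (rule add.generate_subgroup_incl)
  show "S \<subseteq> ideal_mult K S S"
  proof
    fix s assume s: "s \<in> S"
    have "s \<otimes> \<one> \<in> S <#> S" using s subringE(3)[OF S] by (auto simp: set_mult_def)
    moreover have "s \<in> carrier K" using s subringE(1)[OF S] by auto
    ultimately show "s \<in> ideal_mult K S S" unfolding ideal_mult_def by (auto intro: generate.incl)
  qed
qed

definition preimage_module :: "'a set set \<Rightarrow> 'a set" where
  "preimage_module H = generated_module K R {x \<in> maximal_order K. quotient_map K R x \<in> H}"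

text \<open>An over-order \<open>S\<close> is recovered from its image in the quotient: it contains
  \<open>R\<close>, so it is the full preimage of that image, and it is already a module.
  Conversely, every preimage module lies between \<open>R\<close> and the maximal order, so
  idempotence decides.\<close>

lemma over_orders_eq:
  "{preimage_module H | H. subgroup H (order_quotient K R) \<and>
      ideal_mult K (preimage_module H) (preimage_module H) = preimage_module H} = {S. over_order K R S}"
    (is "?A = ?B")
proof
  show "?A \<subseteq> ?B"
  proof
    fix S assume "S \<in> ?A"
    then obtain H where H: "subgroup H (order_quotient K R)" and S: "S = preimage_module H"
      and idem: "ideal_mult K S S = S" by blast
    let ?P = "{x \<in> maximal_order K. quotient_map K R x \<in> H}"
    have "R \<in> H" using subgroup.one_closed[OF H] by (simp add: one_order_quotient)
    then have RP: "R \<subseteq> ?P" using R_subset_maximal_order by (auto simp: quotient_map_R)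
    have "over_order K R S"
    proof (rule over_order_if_idempotent[OF _ _ _ idem])
      show "sub_R_module K R S"
        unfolding S preimage_module_def by (rule sub_R_module_generated) auto
      show "R \<subseteq> S"
        unfolding S preimage_module_def using RP generated_module_superset by (rule subset_trans)
      show "S \<subseteq> maximal_order K"
        unfolding S preimage_module_def by (rule generated_module_least[OF sub_R_module_maximal_order]) auto
    qed
    then show "S \<in> ?B" by simp
  qed
  show "?B \<subseteq> ?A"
  proof
    fix S assume "S \<in> ?B"
    then have over: "over_order K R S" by simp
    note S = over_order_imp[OF over]
    interpret O: ring KO by (rule subring_is_ring[OF subring_maximal_order])
    interpret q: group_hom "add_monoid KO" "order_quotient K R" "quotient_map K R"
      using O.a_group group_order_quotient quotient_map_hom
      by (simp add: group_hom_def group_hom_axioms_def)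
    have "subgroup S (add_monoid K\<lparr>carrier := maximal_order K\<rparr>)"
      using S(2,4) subring_maximal_order by (intro add.subgroup_incl) (auto simp: subring_def)
    then have "subgroup S (add_monoid KO)" by simp
    then have H: "subgroup (quotient_map K R ` S) (order_quotient K R)"
      by (rule q.subgroup_img_is_subgroup)
    have "{x \<in> maximal_order K. quotient_map K R x \<in> quotient_map K R ` S} = S"
    proof
      show "S \<subseteq> {x \<in> maximal_order K. quotient_map K R x \<in> quotient_map K R ` S}" using S(4) by auto
      show "{x \<in> maximal_order K. quotient_map K R x \<in> quotient_map K R ` S} \<subseteq> S"
      proof
        fix x assume "x \<in> {x \<in> maximal_order K. quotient_map K R x \<in> quotient_map K R ` S}"
        then obtain s where x: "x \<in> maximal_order K" and s: "s \<in> S"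
          and "quotient_map K R x = quotient_map K R s" by blast
        moreover have sK: "s \<in> carrier K" using s S(4) by auto
        ultimately have "x \<ominus> s \<in> S" using S(3) by (subst (asm) quotient_map_eq_iff) auto
        then have "(x \<ominus> s) \<oplus> s \<in> S" using s S(1) unfolding sub_R_module_iff by blast
        then show "x \<in> S" using x sK by (simp add: minus_eq a_assoc l_neg)
      qed
    qed
    then have "preimage_module (quotient_map K R ` S) = S"
      unfolding preimage_module_def using generated_module_eq[OF S(1)] by simp
    then show "S \<in> ?A" using H ideal_mult_subring[OF S(2)] by (metis (mono_tags, lifting) mem_Collect_eq)
  qed
qed

lemma over_orders_algorithm_correct:
  assumes "set Hs = {H. subgroup H (order_quotient K R)}"
  shows "set (over_orders_algorithm K R Hs) = {S. over_order K R S}"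
    and "distinct (over_orders_algorithm K R Hs)"
proof -
  have step: "over_orders_step K R L H =
      (if ideal_mult K (preimage_module H) (preimage_module H) = preimage_module H \<and>
          preimage_module H \<notin> set L then L @ [preimage_module H] else L)" for L H
    by (simp add: over_orders_step_def preimage_module_def Let_def)
  show "set (over_orders_algorithm K R Hs) = {S. over_order K R S}"
    "distinct (over_orders_algorithm K R Hs)"
    using foldl_collect[of "over_orders_step K R" "\<lambda>S. ideal_mult K S S = S" preimage_module "[]" Hs, OF step]
    by (simp_all add: over_orders_algorithm_def over_orders_eq[symmetric] assms)
qed

end

text \<open>Finiteness of the set of subgroups is part of the claim because it guarantees that a
  list \<open>Hs\<close> enumerating them exists.\<close>

theorem theorem6p1:
  fixes K :: "('a, 'm) ring_scheme" and R :: "'a set"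
  assumes "order_in R K"
  shows "finite {H. subgroup H (order_quotient K R)} \<and>
    (\<forall>Hs. set Hs = {H. subgroup H (order_quotient K R)} \<longrightarrow>
       set (over_orders_algorithm K R Hs) = {S. over_order K R S} \<and>
       distinct (over_orders_algorithm K R Hs))"
proof -
  interpret cring K using assms by (simp add: order_in_def total_quotient_ring_def)
  \<comment> \<open>A fixed isomorphism of \<open>R\<close> with a free abelian group supplies the
    coordinates that \<open>order_basis\<close> works with.\<close>
  obtain n :: nat and \<phi> where iso: "\<phi> \<in> iso (add_monoid (K\<lparr>carrier := R\<rparr>)) (free_Abelian_group {..<n})"
    using assms by (auto simp: order_in_def is_order_def is_iso_def)
  have "order_basis K R n \<phi>"
  proof
    show "order_in R K" by (rule assms)
    show "\<phi> (r \<oplus>\<^bsub>K\<^esub> s) = \<phi> r + \<phi> s" if "r \<in> R" "s \<in> R" for r s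
      using iso that by (auto simp: iso_def hom_def)
    show "inj_on \<phi> R" "\<phi> ` R = {c. Poly_Mapping.keys c \<subseteq> {..<n}}"
      using iso by (auto simp: iso_def bij_betw_def free_Abelian_group_def)
  qed
  then interpret order_basis K R n \<phi> .
  show ?thesis
    using finite_subgroups_order_quotient over_orders_algorithm_correct by blast
qed

end
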